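(* The following equivalences hold for quantum circuits (all circuits appearing being well-formed, $q$ and $q_1\neq q_2$ being qubits): (1) (Changing Basis) If a unitary $U$ satisfies $U|\varphi_i\rangle=\lambda_i|\psi_i\rangle$ ($i=0,1$) for orthonormal bases $\{|\varphi_0\rangle,|\varphi_1\rangle\}$ and $\{|\psi_0\rangle,|\psi_1\rangle\}$ and phases $\lambda_i$, then $$C_0\stackrel{|\psi_0\rangle}{\leftarrow}q\stackrel{|\psi_1\rangle}{\rightarrow}C_1\;\equiv\;U^\dagger[q];\,\big(C_0\stackrel{|\varphi_0\rangle}{\leftarrow}q\stackrel{|\varphi_1\rangle}{\rightarrow}C_1\big);\,U[q].$$ (2) (Symmetry) $C_0\stackrel{|\varphi_0\rangle}{\leftarrow}q\stackrel{|\varphi_1\rangle}{\rightarrow}C_1\equiv C_1\stackrel{|\varphi_1\rangle}{\leftarrow}q\stackrel{|\varphi_0\rangle}{\rightarrow}C_0$. (3) (Idempotence) $C\leftarrow q\rightarrow C\equiv C$. (4) (Distributivity) If $q_2\notin qv(C)$, then $$C\leftarrow q_1\rightarrow(C_0\leftarrow q_2\rightarrow C_1)\;\equiv\;(C\leftarrow q_1\rightarrow C_0)\leftarrow q_2\rightarrow(C\leftarrow q_1\rightarrow C_1).$$ (5) (Nested qif) $$(C_{00}\leftarrow q_2\rightarrow C_{01})\leftarrow q_1\rightarrow(C_{10}\leftarrow q_2\rightarrow C_{11})\;\equiv\;\mathbf{qif}\,[q_1,q_2]\big(\square_{i,j\in\{0,1\}}|i,j\rangle\to C_{ij}\big)\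,\mathbf{fiq}.$$
   Context: Each quantum variable $q$ has a Hilbert space $\mathcal H_q$. A register $\bar q=q_1,\dots,q_n$ is a finite sequence of distinct variables (identified with its set), with space $\mathcal H_{\bar q}=\bigotimes_i\mathcal H_{q_i}$. A set $\mathcal U$ of unitary constants is fixed (those named in the claim belong to it); $U[\bar q]$ is a basic gate when the type of $U$ matches $\bar q$. Circuits: $C::=\mathbf{skip}\mid U[\bar q]\mid C_1;C_2\mid \mathbf{qif}\,[\bar q](\square_{i=1}^d|\psi_i\rangle\to C_i)\,\mathbf{fiq}$, where (well-formedness) $\{|\psi_i\rangle\}_{i=1}^d$ is an orthonormal basis of $\mathcal H_{\bar q}$ and $\bar q\cap\bigcup_iqv(C_i)=\emptyset$; $qv(C)$ is the set of variables occurring in $C$. Semantics: $[\![C]\!]$ is the unitary on $\mathcal H_{qv(C)}$ with $[\![\mathbf{skip}]\!]=I$, $[\![U[\bar q]]\!]=U_{\bar q}$, $[\![C_1;C_2]\!]=[\![C_2]\!][\![C_1]\!]$, $[\![\mathbf{qif}\,[\bar q](\square_i|\psi_i\rangle\to C_i)\,\mathbf{fiq}]\!]=\sum_i|\psi_i\rangle_{\bar q}\langle\psi_i|\otimes[\![C_i]\!]$, operators being extended by the identity to all variables of the whole circuit. $C_1\equiv C_2$ iff $[\![C_1]\!]\otimes I_{qv(C_2)\setminus qv(C_1)}=[\![C_2]\!]\otimes I_{qv(C_1)\setminus qv(C_2)}$. For a qubit $q$ and an orthonormal basis $|\varphi_0\rangle,|\varphi_1\rangle$ of $\mathcal H_q$,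 $C_0\stackrel{|\varphi_0\rangle}{\leftarrow}q\stackrel{|\varphi_1\rangle}{\rightarrow}C_1$ denotes $\mathbf{qif}\,[q](|\varphi_0\rangle\to C_0\ \square\ |\varphi_1\rangle\to C_1)\,\mathbf{fiq}$. When the basis is fixed (e.g. the computational basis $|0\rangle,|1\rangle$) it is abbreviated $C_0\leftarrow q\rightarrow C_1$, the same basis being used for each occurrence of the same qubit. *)

theory Defs
  imports "HOL-Analysis.Analysis"
begin

section \<open>Hilbert spaces\<close>

text \<open>
  Every Hilbert space is, up to a choice of orthonormal basis, the space of square-summable
  functions on a label set \<open>X\<close>.  Its elements are represented by functions vanishing outside \<open>X\<close>,
  its operators by functions that are \<^const>\<open>extensional\<close> on it, so that equality of operators
  is equality in HOL.
\<close>

definition ell2 :: "'x set \<Rightarrow> ('x \<Rightarrow> complex) set" where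
  "ell2 X = {f. (\<forall>x. x \<notin> X \<longrightarrow> f x = 0) \<and> (\<lambda>x. (cmod (f x))\<^sup>2) summable_on X}"

definition inner2 :: "'x set \<Rightarrow> ('x \<Rightarrow> complex) \<Rightarrow> ('x \<Rightarrow> complex) \<Rightarrow> complex" where
  "inner2 X f g = (\<Sum>\<^sub>\<infinity>x\<in>X. cnj (f x) * g x)"

definition unitary :: "'x set \<Rightarrow> (('x \<Rightarrow> complex) \<Rightarrow> ('x \<Rightarrow> complex)) \<Rightarrow> bool" where
  "unitary X U \<longleftrightarrow>
     U \<in> extensional (ell2 X) \<and> bij_betw U (ell2 X) (ell2 X) \<and>
     (\<forall>f\<in>ell2 X. \<forall>g\<in>ell2 X. U (\<lambda>x. f x + g x) = (\<lambda>x. U f x + U g x)) \<and>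
     (\<forall>f\<in>ell2 X. \<forall>a. U (\<lambda>x. a * f x) = (\<lambda>x. a * U f x)) \<and>
     (\<forall>f\<in>ell2 X. \<forall>g\<in>ell2 X. inner2 X (U f) (U g) = inner2 X f g)"

definition adj :: "'x set \<Rightarrow> (('x \<Rightarrow> complex) \<Rightarrow> ('x \<Rightarrow> complex)) \<Rightarrow>
    (('x \<Rightarrow> complex) \<Rightarrow> ('x \<Rightarrow> complex))" where
  "adj X U = (\<lambda>g\<in>ell2 X. THE h. h \<in> ell2 X \<and> (\<forall>f\<in>ell2 X. inner2 X (U f) g = inner2 X f h))"

text \<open>A finite orthonormal basis; since it is finite, no closure of the span is needed.\<close>

definition onb :: "'x set \<Rightarrow> ('x \<Rightarrow> complex) list \<Rightarrow> bool" where
  "onb X \<psi>s \<longleftrightarrow>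
     set \<psi>s \<subseteq> ell2 X \<and>
     (\<forall>i<length \<psi>s. \<forall>j<length \<psi>s. inner2 X (\<psi>s ! i) (\<psi>s ! j) = (if i = j then 1 else 0)) \<and>
     (\<forall>f\<in>ell2 X. \<exists>c. f = (\<lambda>x. \<Sum>i<length \<psi>s. c i * (\<psi>s ! i) x))"

definition ketbra :: "'x set \<Rightarrow> ('x \<Rightarrow> complex) \<Rightarrow> (('x \<Rightarrow> complex) \<Rightarrow> ('x \<Rightarrow> complex))" where
  "ketbra X \<psi> = (\<lambda>\<phi>\<in>ell2 X. \<lambda>x. inner2 X \<psi> \<phi> * \<psi> x)"


section \<open>Quantum variables and registers\<close>

text \<open>
  The parameter \<open>B :: 'v \<Rightarrow> 'b set\<close> below gives the state space of each variable \<open>q\<close> as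
  \<open>ell2 (B q)\<close>.  There are two forms of a tensor product of such spaces.  For an ordered register
  \<open>qs\<close> it is \<open>ell2\<close> of the set \<open>listset (map B qs)\<close> of label tuples; gates and the bases of
  \<open>qif\<close> live there.  For a set \<open>V\<close> of variables it is \<open>ell2\<close> of the set of assignments
  \<open>PiE V B\<close>; the semantics lives there.
\<close>

abbreviation tuples :: "('v \<Rightarrow> 'b set) \<Rightarrow> 'v list \<Rightarrow> 'b list set" where
  "tuples B qs \<equiv> listset (map B qs)"

definition hilb :: "('v \<Rightarrow> 'b set) \<Rightarrow> 'v set \<Rightarrow> (('v \<Rightarrow> 'b) \<Rightarrow> complex) set" where
  "hilb B V = ell2 (PiE V B)"

definition qubit :: "('v \<Rightarrow> 'b set) \<Rightarrow> 'v \<Rightarrow> bool" where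
  "qubit B q \<longleftrightarrow> card (B q) = 2"

text \<open>The vector \<open>\<phi> \<otimes> \<xi>\<close> for a one-variable register followed by another register.\<close>

definition ket_tensor :: "('b list \<Rightarrow> complex) \<Rightarrow> ('b list \<Rightarrow> complex) \<Rightarrow> ('b list \<Rightarrow> complex)" where
  "ket_tensor \<phi> \<xi> = (\<lambda>bs. \<phi> (take 1 bs) * \<xi> (drop 1 bs))"

text \<open>
  \<open>on_reg B qs A\<close> is the operator \<open>A\<close> on tuples transported to \<open>hilb B (set qs)\<close> along the
  bijection \<open>\<lambda>x. map x qs\<close> (for distinct \<open>qs\<close>) from assignments to tuples.
\<close>

definition on_reg :: "('v \<Rightarrow> 'b set) \<Rightarrow> 'v list \<Rightarrow>
    (('b list \<Rightarrow> complex) \<Rightarrow> ('b list \<Rightarrow> complex)) \<Rightarrow>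
    ((('v \<Rightarrow> 'b) \<Rightarrow> complex) \<Rightarrow> (('v \<Rightarrow> 'b) \<Rightarrow> complex))" where
  "on_reg B qs A = (\<lambda>\<Psi>\<in>hilb B (set qs). \<lambda>x.
     if x \<in> PiE (set qs) B
     then A (\<lambda>bs. if bs \<in> tuples B qs
                  then \<Psi> (inv_into (PiE (set qs) B) (\<lambda>y. map y qs) bs) else 0) (map x qs)
     else 0)"

text \<open>
  \<open>op_ext B V W A\<close> is \<open>A \<otimes> I\<close> on \<open>hilb B W\<close> for an operator \<open>A\<close> on \<open>hilb B V\<close> and \<open>V \<subseteq> W\<close>: for each
  assignment to the variables of \<open>W - V\<close>, \<open>A\<close> is applied to the corresponding slice
  of \<open>\<Psi>\<close>, which is a vector of \<open>hilb B V\<close>.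
\<close>

definition op_ext :: "('v \<Rightarrow> 'b set) \<Rightarrow> 'v set \<Rightarrow> 'v set \<Rightarrow>
    ((('v \<Rightarrow> 'b) \<Rightarrow> complex) \<Rightarrow> (('v \<Rightarrow> 'b) \<Rightarrow> complex)) \<Rightarrow>
    ((('v \<Rightarrow> 'b) \<Rightarrow> complex) \<Rightarrow> (('v \<Rightarrow> 'b) \<Rightarrow> complex))" where
  "op_ext B V W A = (\<lambda>\<Psi>\<in>hilb B W. \<lambda>x.
     if x \<in> PiE W B
     then A (\<lambda>y. if y \<in> PiE V B then \<Psi> (override_on x y V) else 0) (restrict x V)
     else 0)"


section \<open>Quantum circuits\<close>

text \<open>A unitary constant carries its type, the list of label sets of the variables it acts on.\<close>

datatype 'b uconst =
  UConst (utype: "'b set list") (uop: "('b list \<Rightarrow> complex) \<Rightarrow> ('b list \<Rightarrow> complex)")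

definition dagger :: "'b uconst \<Rightarrow> 'b uconst" where
  "dagger U = UConst (utype U) (adj (listset (utype U)) (uop U))"

datatype ('v, 'b) circuit =
    Skip
  | Gate "'b uconst" "'v list"
  | Seq "('v, 'b) circuit" "('v, 'b) circuit"
  | Qif "'v list" "(('b list \<Rightarrow> complex) \<times> ('v, 'b) circuit) list"

fun qv :: "('v, 'b) circuit \<Rightarrow> 'v set" where
  "qv Skip = {}"
| "qv (Gate U qs) = set qs"
| "qv (Seq C D) = qv C \<union> qv D"
| "qv (Qif qs bs) = set qs \<union> (\<Union>(\<psi>, C)\<in>set bs. qv C)"

fun wf_circuit :: "('v \<Rightarrow> 'b set) \<Rightarrow> 'b uconst set \<Rightarrow> ('v, 'b) circuit \<Rightarrow> bool" where
  "wf_circuit B \<U> Skip \<longleftrightarrow> True"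
| "wf_circuit B \<U> (Gate U qs) \<longleftrightarrow> U \<in> \<U> \<and> distinct qs \<and> utype U = map B qs"
| "wf_circuit B \<U> (Seq C D) \<longleftrightarrow> wf_circuit B \<U> C \<and> wf_circuit B \<U> D"
| "wf_circuit B \<U> (Qif qs bs) \<longleftrightarrow>
     distinct qs \<and> onb (tuples B qs) (map fst bs) \<and>
     (\<forall>(\<psi>, C)\<in>set bs. wf_circuit B \<U> C \<and> set qs \<inter> qv C = {})"

text \<open>
  \<open>sem B C\<close> is an operator on \<open>hilb B (qv C)\<close>.  In the last clause, \<open>|\<psi>\<rangle>\<langle>\<psi>| \<otimes> sem B C\<close> is written
  as the product of the two factors, each extended by the identity to the whole circuit.
\<close>

fun sem :: "('v \<Rightarrow> 'b set) \<Rightarrow> ('v, 'b) circuit \<Rightarrow>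
    ((('v \<Rightarrow> 'b) \<Rightarrow> complex) \<Rightarrow> (('v \<Rightarrow> 'b) \<Rightarrow> complex))" where
  "sem B Skip = (\<lambda>\<Psi>\<in>hilb B {}. \<Psi>)"
| "sem B (Gate U qs) = on_reg B qs (uop U)"
| "sem B (Seq C D) =
     compose (hilb B (qv C \<union> qv D))
       (op_ext B (qv D) (qv C \<union> qv D) (sem B D)) (op_ext B (qv C) (qv C \<union> qv D) (sem B C))"
| "sem B (Qif qs bs) =
     (\<lambda>\<Psi>\<in>hilb B (qv (Qif qs bs)). \<lambda>x. \<Sum>(\<psi>, C)\<leftarrow>bs.
        op_ext B (set qs) (qv (Qif qs bs)) (on_reg B qs (ketbra (tuples B qs) \<psi>))
          (op_ext B (qv C) (qv (Qif qs bs)) (sem B C) \<Psi>) x)"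

definition circuit_equiv :: "('v \<Rightarrow> 'b set) \<Rightarrow> ('v, 'b) circuit \<Rightarrow> ('v, 'b) circuit \<Rightarrow> bool" where
  "circuit_equiv B C D \<longleftrightarrow>
     op_ext B (qv C) (qv C \<union> qv D) (sem B C) = op_ext B (qv D) (qv C \<union> qv D) (sem B D)"

text \<open>\<open>branch C0 \<phi>0 q \<phi>1 C1\<close> takes its arguments in the order of the arrow notation
  \<open>C0 \<leftarrow> q \<rightarrow> C1\<close>, with \<open>\<phi>0\<close>, \<open>\<phi>1\<close> labelling the left and the right arrow.\<close>

definition branch :: "('v, 'b) circuit \<Rightarrow> ('b list \<Rightarrow> complex) \<Rightarrow> 'v \<Rightarrow> ('b list \<Rightarrow> complex) \<Rightarrow>
    ('v, 'b) circuit \<Rightarrow> ('v, 'b) circuit" where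
  "branch C0 \<phi>0 q \<phi>1 C1 = Qif [q] [(\<phi>0, C0), (\<phi>1, C1)]"

end

theory Submission
  imports Defs
begin

text \<open>
  Both sides of each law are extended to the space of all variables involved.  There a
  \<open>qif\<close> on a qubit becomes the sum of products \<open>P\<^sub>i E\<^sub>i\<close>, where \<open>P\<^sub>i\<close> projects
  the qubit onto \<open>|\<psi>\<^sub>i\<rangle>\<close> and \<open>E\<^sub>i\<close> is the extended branch, and the laws reduce to
  \<open>P\<^sub>0 + P\<^sub>1 = I\<close>, to the commutation of projectors on different qubits, and to
  \<open>U P\<^sub>i U\<^sup>\<dagger>\<close> being the projector onto the image of the \<open>i\<close>-th basis vector.
  Since the label set of a qubit is finite, an operator on it acts as a finite sum
  over values of that qubit, so it commutes with an extended operator on other variables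
  by linearity alone.  The other variables may have infinite-dimensional spaces; there
  boundedness of the circuit semantics is what keeps \<open>A \<otimes> I\<close> inside the space of
  square-summable functions.
\<close>

section \<open>Bounded operators on square-summable functions\<close>

definition nsq :: "'x set \<Rightarrow> ('x \<Rightarrow> complex) \<Rightarrow> real" where
  "nsq X f = (\<Sum>\<^sub>\<infinity>x\<in>X. (cmod (f x))\<^sup>2)"

lemma nsq_nonneg: "0 \<le> nsq X f"
  unfolding nsq_def by (rule infsum_nonneg) simp

lemma ell2_outside: "f \<in> ell2 X \<Longrightarrow> x \<notin> X \<Longrightarrow> f x = 0"
  by (simp add: ell2_def)

lemma ell2_summable: "f \<in> ell2 X \<Longrightarrow> (\<lambda>x. (cmod (f x))\<^sup>2) summable_on X"
  by (simp add: ell2_def)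

lemma ell2_finite: "finite X \<Longrightarrow> (\<And>x. x \<notin> X \<Longrightarrow> f x = 0) \<Longrightarrow> f \<in> ell2 X"
  by (simp add: ell2_def)

lemma ell2_zero: "(\<lambda>x. 0) \<in> ell2 X"
  by (simp add: ell2_def)

lemma ell2_scale: "f \<in> ell2 X \<Longrightarrow> (\<lambda>x. a * f x) \<in> ell2 X"
  by (auto simp: ell2_def norm_mult power_mult_distrib intro: summable_on_cmult_right)

lemma nsq_scale: "nsq X (\<lambda>x. a * f x) = (cmod a)\<^sup>2 * nsq X f"
  by (simp add: nsq_def norm_mult power_mult_distrib infsum_cmult_right')

text \<open>By 2ab \<le> a^2 + b^2. This crude form of the triangle inequality suffices below, where
  squared norms have to be finite and bounded but no constant has to be sharp.\<close>

lemma cmod_add_sq: "(cmod (a + b))\<^sup>2 \<le> 2 * (cmod a)\<^sup>2 + 2 * (cmod b)\<^sup>2"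
proof -
  have "(cmod (a + b))\<^sup>2 \<le> (cmod a + cmod b)\<^sup>2"
    by (intro power_mono norm_triangle_ineq) simp
  also have "\<dots> \<le> 2 * (cmod a)\<^sup>2 + 2 * (cmod b)\<^sup>2"
    using sum_squares_bound[of "cmod a" "cmod b"] by (simp add: power2_sum)
  finally show ?thesis .
qed

lemma
  assumes "f \<in> ell2 X" and "g \<in> ell2 X"
  shows ell2_add: "(\<lambda>x. f x + g x) \<in> ell2 X"
    and nsq_add: "nsq X (\<lambda>x. f x + g x) \<le> 2 * nsq X f + 2 * nsq X g"
proof -
  note s = assms[THEN ell2_summable]
  have d: "(\<lambda>x. 2 * (cmod (f x))\<^sup>2 + 2 * (cmod (g x))\<^sup>2) summable_on X"
    by (intro summable_on_add summable_on_cmult_right s)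
  have c: "(\<lambda>x. (cmod (f x + g x))\<^sup>2) summable_on X"
    by (rule summable_on_comparison_test[OF d cmod_add_sq]) simp
  show "(\<lambda>x. f x + g x) \<in> ell2 X"
    using assms c by (simp add: ell2_def)
  have "nsq X (\<lambda>x. f x + g x) \<le> (\<Sum>\<^sub>\<infinity>x\<in>X. 2 * (cmod (f x))\<^sup>2 + 2 * (cmod (g x))\<^sup>2)"
    unfolding nsq_def by (rule infsum_mono[OF c d cmod_add_sq])
  also have "\<dots> = 2 * nsq X f + 2 * nsq X g"
    unfolding nsq_def infsum_cmult_right'[symmetric] by (intro infsum_add summable_on_cmult_right s)
  finally show "nsq X (\<lambda>x. f x + g x) \<le> 2 * nsq X f + 2 * nsq X g" .
qed

lemma ell2_sum:
  assumes "finite I" and "\<And>i. i \<in> I \<Longrightarrow> g i \<in> ell2 X"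
  shows "(\<lambda>x. \<Sum>i\<in>I. g i x) \<in> ell2 X"
  using assms by (induction I rule: finite_induct) (auto simp: ell2_zero ell2_add)

text \<open>Domination by the sum of the two squared moduli, again from 2ab \<le> a^2 + b^2. It
  makes \<open>inner2\<close> a convergent sum; otherwise \<open>infsum\<close> would return its
  default value 0 and additivity could fail.\<close>

lemma inner2_summable:
  assumes "f \<in> ell2 X" and "g \<in> ell2 X"
  shows "(\<lambda>x. cmod (cnj (f x) * g x)) summable_on X"
proof (rule summable_on_comparison_test)
  show "(\<lambda>x. (cmod (f x))\<^sup>2 + (cmod (g x))\<^sup>2) summable_on X"
    by (intro summable_on_add assms[THEN ell2_summable])
  show "cmod (cnj (f x) * g x) \<le> (cmod (f x))\<^sup>2 + (cmod (g x))\<^sup>2" for x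
  proof -
    have "0 \<le> cmod (f x) * cmod (g x)"
      by simp
    then show ?thesis
      using sum_squares_bound[of "cmod (f x)" "cmod (g x)"] unfolding norm_mult complex_mod_cnj by linarith
  qed
qed simp

lemma inner2_add_right:
  assumes "f \<in> ell2 X" and "g \<in> ell2 X" and "h \<in> ell2 X"
  shows "inner2 X f (\<lambda>x. g x + h x) = inner2 X f g + inner2 X f h"
  unfolding inner2_def distrib_left
  using assms by (intro infsum_add) (auto intro: abs_summable_summable[OF inner2_summable])

lemma inner2_scale_right: "inner2 X f (\<lambda>x. a * g x) = a * inner2 X f g"
  by (simp add: inner2_def infsum_cmult_right' mult.left_commute)

lemma inner2_self:
  assumes "f \<in> ell2 X"
  shows "inner2 X f f = of_real (nsq X f)"
proof -
  have "((\<lambda>x. complex_of_real ((cmod (f x))\<^sup>2)) has_sum of_real (nsq X f)) X"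
    unfolding nsq_def has_sum_of_real_iff by (intro has_sum_infsum ell2_summable assms)
  then show ?thesis
    unfolding inner2_def by (intro infsumI) (simp add: complex_norm_square mult.commute del: of_real_power)
qed

text \<open>The finite inequality holds on every finite subset, where both factors are at most the
  full squared norms; a bound on all finite partial sums bounds the absolute sum.\<close>

lemma Cauchy_Schwarz_inner2:
  assumes f: "f \<in> ell2 X" and g: "g \<in> ell2 X"
  shows "(cmod (inner2 X f g))\<^sup>2 \<le> nsq X f * nsq X g"
proof -
  have part: "(\<Sum>x\<in>F. (cmod (h x))\<^sup>2) \<le> nsq X h" if "h \<in> ell2 X" "finite F" "F \<subseteq> X" for h F
    unfolding nsq_def using that by (intro finite_sum_le_infsum ell2_summable) auto
  have "cmod (inner2 X f g) \<le> (\<Sum>\<^sub>\<infinity>x\<in>X. cmod (cnj (f x) * g x))"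
    unfolding inner2_def by (intro norm_infsum_bound inner2_summable f g)
  also have "\<dots> \<le> sqrt (nsq X f * nsq X g)"
  proof (rule infsum_le_finite_sums[OF inner2_summable[OF f g]])
    fix F assume F: "finite F" "F \<subseteq> X"
    have "(\<Sum>x\<in>F. cmod (cnj (f x) * g x))\<^sup>2 \<le> (\<Sum>x\<in>F. (cmod (f x))\<^sup>2) * (\<Sum>x\<in>F. (cmod (g x))\<^sup>2)"
      using Cauchy_Schwarz_ineq_sum[of "\<lambda>x. cmod (f x)" "\<lambda>x. cmod (g x)" F] by (simp add: norm_mult)
    also have "\<dots> \<le> nsq X f * nsq X g"
      using f g F by (intro mult_mono part nsq_nonneg sum_nonneg) auto
    finally show "(\<Sum>x\<in>F. cmod (cnj (f x) * g x)) \<le> sqrt (nsq X f * nsq X g)"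
      by (rule real_le_rsqrt)
  qed
  finally have "(cmod (inner2 X f g))\<^sup>2 \<le> (sqrt (nsq X f * nsq X g))\<^sup>2"
    by (intro power_mono) auto
  then show ?thesis
    by (simp add: nsq_nonneg)
qed

text \<open>\<open>K\<close> bounds squared norms, so it is the square of a bound on the operator
  norm. Nothing is asked outside \<open>ell2 X\<close>, so the notion covers extensional operators
  and plain lambda terms alike.\<close>

definition bounded_op :: "'x set \<Rightarrow> (('x \<Rightarrow> complex) \<Rightarrow> ('x \<Rightarrow> complex)) \<Rightarrow> bool" where
  "bounded_op X A \<longleftrightarrow>
     (\<forall>f\<in>ell2 X. A f \<in> ell2 X) \<and>
     (\<forall>f\<in>ell2 X. \<forall>g\<in>ell2 X. A (\<lambda>x. f x + g x) = (\<lambda>x. A f x + A g x)) \<and>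
     (\<forall>f\<in>ell2 X. \<forall>a. A (\<lambda>x. a * f x) = (\<lambda>x. a * A f x)) \<and>
     (\<exists>K\<ge>0. \<forall>f\<in>ell2 X. nsq X (A f) \<le> K * nsq X f)"

lemma
  assumes "bounded_op X A" and "f \<in> ell2 X"
  shows bounded_op_ell2: "A f \<in> ell2 X"
    and bounded_op_add: "g \<in> ell2 X \<Longrightarrow> A (\<lambda>x. f x + g x) = (\<lambda>x. A f x + A g x)"
    and bounded_op_scale: "A (\<lambda>x. a * f x) = (\<lambda>x. a * A f x)"
  using assms by (auto simp: bounded_op_def)

lemma bounded_op_bound:
  assumes "bounded_op X A"
  obtains K where "K \<ge> 0" and "\<And>f. f \<in> ell2 X \<Longrightarrow> nsq X (A f) \<le> K * nsq X f"
  using assms by (auto simp: bounded_op_def)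

lemma bounded_op_sum:
  assumes A: "bounded_op X A" and "finite I" and "\<And>i. i \<in> I \<Longrightarrow> g i \<in> ell2 X"
  shows "A (\<lambda>x. \<Sum>i\<in>I. c i * g i x) = (\<lambda>x. \<Sum>i\<in>I. c i * A (g i) x)"
  using assms(2,3)
proof (induction I rule: finite_induct)
  case empty
  show ?case
    using bounded_op_scale[OF A ell2_zero, of 0] by simp
next
  case (insert i I)
  then show ?case
    by (simp add: bounded_op_add[OF A] bounded_op_scale[OF A] ell2_scale ell2_sum)
qed

section \<open>Closure properties and examples of bounded operators\<close>

lemma bounded_op_cong:
  assumes "bounded_op X A" and "\<And>f. f \<in> ell2 X \<Longrightarrow> A' f = A f"
  shows "bounded_op X A'"
  using assms unfolding bounded_op_def by (auto simp: ell2_add ell2_scale)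

lemma bounded_op_zero: "bounded_op X (\<lambda>f x. 0)"
  by (auto simp: bounded_op_def ell2_zero nsq_def intro!: exI[of _ 0])

lemma bounded_op_id: "bounded_op X (\<lambda>f. f)"
  by (auto simp: bounded_op_def intro!: exI[of _ 1])

lemma bounded_op_plus:
  assumes "bounded_op X A" and "bounded_op X A'"
  shows "bounded_op X (\<lambda>f x. A f x + A' f x)"
proof -
  obtain K where K: "K \<ge> 0" "\<And>f. f \<in> ell2 X \<Longrightarrow> nsq X (A f) \<le> K * nsq X f"
    using bounded_op_bound[OF assms(1)] by blast
  obtain L where L: "L \<ge> 0" "\<And>f. f \<in> ell2 X \<Longrightarrow> nsq X (A' f) \<le> L * nsq X f"
    using bounded_op_bound[OF assms(2)] by blast
  have "nsq X (\<lambda>x. A f x + A' f x) \<le> (2 * K + 2 * L) * nsq X f" if f: "f \<in> ell2 X" for f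
    using nsq_add[OF assms[THEN bounded_op_ell2[OF _ f]]] K(2)[OF f] L(2)[OF f]
    by (simp add: algebra_simps)
  then show ?thesis
    using K(1) L(1) unfolding bounded_op_def
    by (auto simp: ell2_add assms[THEN bounded_op_ell2] assms[THEN bounded_op_add]
        assms[THEN bounded_op_scale] algebra_simps intro!: exI[of _ "2 * K + 2 * L"])
qed

lemma bounded_op_sum_list:
  assumes "\<And>p. p \<in> set ps \<Longrightarrow> bounded_op X (A p)"
  shows "bounded_op X (\<lambda>f x. \<Sum>p\<leftarrow>ps. A p f x)"
  using assms by (induction ps) (simp_all add: bounded_op_zero bounded_op_plus)

lemma bounded_op_comp:
  assumes "bounded_op X A" and "bounded_op X A'"
  shows "bounded_op X (\<lambda>f. A (A' f))"
proof -
  obtain K where K: "K \<ge> 0" "\<And>f. f \<in> ell2 X \<Longrightarrow> nsq X (A f) \<le> K * nsq X f"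
    using bounded_op_bound[OF assms(1)] by blast
  obtain L where L: "L \<ge> 0" "\<And>f. f \<in> ell2 X \<Longrightarrow> nsq X (A' f) \<le> L * nsq X f"
    using bounded_op_bound[OF assms(2)] by blast
  have "nsq X (A (A' f)) \<le> (K * L) * nsq X f" if f: "f \<in> ell2 X" for f
    using K(2)[OF bounded_op_ell2[OF assms(2) f]] mult_left_mono[OF L(2)[OF f] K(1)]
    by (simp add: mult.assoc)
  then show ?thesis
    using K(1) L(1) unfolding bounded_op_def
    by (auto simp: assms[THEN bounded_op_ell2] assms[THEN bounded_op_add]
        assms[THEN bounded_op_scale] intro!: exI[of _ "K * L"])
qed

text \<open>Taking both arguments of the preserved inner product equal shows that squared norms are
  preserved, so \<open>K = 1\<close> works.\<close>

lemma bounded_op_unitary: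
  assumes "unitary X U"
  shows "bounded_op X U"
proof -
  have maps: "U f \<in> ell2 X" if "f \<in> ell2 X" for f
    using assms that by (auto simp: unitary_def bij_betw_def)
  have "complex_of_real (nsq X (U f)) = of_real (nsq X f)" if f: "f \<in> ell2 X" for f
    using assms f unfolding inner2_self[OF f, symmetric] inner2_self[OF maps[OF f], symmetric] unitary_def
    by blast
  then show ?thesis
    using assms maps unfolding bounded_op_def unitary_def by (auto intro!: exI[of _ 1])
qed

text \<open>Cauchy-Schwarz bounds the squared coefficient by \<open>nsq X \<psi> * nsq X f\<close>;
  scaling \<open>\<psi>\<close> by that coefficient contributes the second factor
  \<open>nsq X \<psi>\<close> of the constant.\<close>

lemma bounded_op_ketbra:
  assumes "\<psi> \<in> ell2 X"
  shows "bounded_op X (ketbra X \<psi>)"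
proof -
  have "nsq X (ketbra X \<psi> f) \<le> (nsq X \<psi> * nsq X \<psi>) * nsq X f" if f: "f \<in> ell2 X" for f
    using mult_right_mono[OF Cauchy_Schwarz_inner2[OF assms f] nsq_nonneg[of X \<psi>]]
    by (simp add: ketbra_def f nsq_scale mult.assoc mult.commute[of "nsq X f"])
  moreover have "ketbra X \<psi> f \<in> ell2 X" if "f \<in> ell2 X" for f
    using that ell2_scale[OF assms] by (simp add: ketbra_def)
  moreover have "ketbra X \<psi> (\<lambda>x. f x + g x) = (\<lambda>x. ketbra X \<psi> f x + ketbra X \<psi> g x)"
    if "f \<in> ell2 X" "g \<in> ell2 X" for f g
    using that by (simp add: ketbra_def ell2_add inner2_add_right[OF assms] distrib_right)
  moreover have "ketbra X \<psi> (\<lambda>x. a * f x) = (\<lambda>x. a * ketbra X \<psi> f x)" if "f \<in> ell2 X" for f a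
    using that by (simp add: ketbra_def ell2_scale inner2_scale_right mult.assoc)
  ultimately show ?thesis
    unfolding bounded_op_def
    by (intro conjI ballI allI exI[of _ "nsq X \<psi> * nsq X \<psi>"] mult_nonneg_nonneg nsq_nonneg) simp_all
qed

section \<open>Extension of operators by the identity\<close>

text \<open>The argument to which \<open>op_ext\<close> applies its operator. The value 0 off
  \<open>PiE V B\<close> is what membership in \<open>hilb B V\<close> requires.\<close>

definition slice :: "('v \<Rightarrow> 'b set) \<Rightarrow> 'v set \<Rightarrow> ('v \<Rightarrow> 'b) \<Rightarrow>
    (('v \<Rightarrow> 'b) \<Rightarrow> complex) \<Rightarrow> (('v \<Rightarrow> 'b) \<Rightarrow> complex)" where
  "slice B V x \<Psi> = (\<lambda>y. if y \<in> PiE V B then \<Psi> (override_on x y V) else 0)"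

lemma op_ext_apply:
  assumes "\<Psi> \<in> hilb B W" and "x \<in> PiE W B"
  shows "op_ext B V W A \<Psi> x = A (slice B V x \<Psi>) (restrict x V)"
  using assms by (simp add: op_ext_def slice_def)

lemma op_ext_outside:
  assumes "\<Psi> \<in> hilb B W" and "x \<notin> PiE W B"
  shows "op_ext B V W A \<Psi> x = 0"
  using assms by (simp add: op_ext_def)

lemma override_on_PiE:
  assumes "V \<subseteq> W" and "x \<in> PiE W B" and "y \<in> PiE V B"
  shows "override_on x y V \<in> PiE W B"
  using assms by (auto simp: override_on_def PiE_iff extensional_def)

lemma restrict_PiE_subset:
  assumes "V \<subseteq> W" and "x \<in> PiE W B"
  shows "restrict x V \<in> PiE V B"
  using assms by (auto simp: PiE_iff)

text \<open>Inside \<open>V\<close> the base point is overwritten by the argument of the slice, so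
  only its values outside \<open>V\<close> matter. The slices of a vector thus form a family indexed
  by assignments to \<open>W - V\<close>.\<close>

lemma slice_override_on: "slice B V (override_on z y V) \<Psi> = slice B V z \<Psi>"
proof -
  have "override_on (override_on z y V) y' V = override_on z y' V" for y'
    by (simp add: override_on_def fun_eq_iff)
  then show ?thesis
    by (simp only: slice_def)
qed

lemma restrict_override_on:
  assumes "y \<in> PiE V B"
  shows "restrict (override_on x y V) V = y"
  using assms by (auto simp: override_on_def fun_eq_iff PiE_iff extensional_def)

text \<open>Distinct assignments to \<open>V\<close> give distinct assignments to \<open>W\<close>,
  since restriction to \<open>V\<close> undoes the override. The squared norm of a slice is
  therefore a sum over part of the labels that occur for \<open>\<Psi>\<close>.\<close>

lemma slice_ell2:
  assumes "V \<subseteq> W" and "\<Psi> \<in> hilb B W" and "x \<in> PiE W B"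
  shows "slice B V x \<Psi> \<in> hilb B V"
proof -
  let ?h = "\<lambda>y. override_on x y V"
  have inj: "inj_on ?h (PiE V B)"
    by (rule inj_on_inverseI[where g = "\<lambda>x. restrict x V"]) (rule restrict_override_on)
  have "(\<lambda>x. (cmod (\<Psi> x))\<^sup>2) summable_on ?h ` PiE V B"
  proof (rule summable_on_subset_banach)
    show "(\<lambda>x. (cmod (\<Psi> x))\<^sup>2) summable_on PiE W B"
      using assms(2) by (simp add: hilb_def ell2_summable)
    show "?h ` PiE V B \<subseteq> PiE W B"
      using override_on_PiE[OF assms(1,3)] by blast
  qed
  then have "(\<lambda>y. (cmod (\<Psi> (?h y)))\<^sup>2) summable_on PiE V B"
    by (simp add: summable_on_reindex[OF inj] o_def)
  then have "(\<lambda>y. (cmod (slice B V x \<Psi> y))\<^sup>2) summable_on PiE V B"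
    by (rule summable_on_cong[THEN iffD1, rotated]) (simp add: slice_def)
  then show ?thesis
    by (simp add: hilb_def ell2_def slice_def)
qed

lemma slice_add: "slice B V x (\<lambda>x. \<Phi> x + \<Psi> x) = (\<lambda>y. slice B V x \<Phi> y + slice B V x \<Psi> y)"
  by (auto simp: slice_def)

lemma slice_scale: "slice B V x (\<lambda>x. a * \<Psi> x) = (\<lambda>y. a * slice B V x \<Psi> y)"
  by (auto simp: slice_def)

text \<open>The two parts of an assignment are recovered by restriction. The bijection turns sums
  over \<open>PiE W B\<close> into double sums.\<close>

lemma bij_betw_override_on:
  assumes "V \<subseteq> W"
  shows "bij_betw (\<lambda>(z, y). override_on z y V) (PiE (W - V) B \<times> PiE V B) (PiE W B)"
proof (rule bij_betwI[where g = "\<lambda>x. (restrict x (W - V), restrict x V)"])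
  show "(\<lambda>(z, y). override_on z y V) \<in> PiE (W - V) B \<times> PiE V B \<rightarrow> PiE W B"
    using assms by (auto simp: override_on_def PiE_iff extensional_def)
  show "(\<lambda>x. (restrict x (W - V), restrict x V)) \<in> PiE W B \<rightarrow> PiE (W - V) B \<times> PiE V B"
    using assms by (auto simp: PiE_iff)
  show "(restrict ((\<lambda>(z, y). override_on z y V) p) (W - V), restrict ((\<lambda>(z, y). override_on z y V) p) V) = p"
    if "p \<in> PiE (W - V) B \<times> PiE V B" for p
    using that by (auto simp: restrict_override_on) (auto simp: override_on_def fun_eq_iff PiE_iff extensional_def)
  show "(\<lambda>(z, y). override_on z y V) (restrict x (W - V), restrict x V) = x" if "x \<in> PiE W B" for x
    using that by (auto simp: override_on_def fun_eq_iff PiE_iff extensional_def)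
qed

text \<open>The squared norm of a vector is the sum of the squared norms of its slices.
  \<open>A\<close> acts on every slice with the same constant \<open>K\<close>, and summing over the
  slices yields this constant for the extension.\<close>

lemma bounded_op_ext:
  assumes VW: "V \<subseteq> W" and A: "bounded_op (PiE V B) A"
  shows "bounded_op (PiE W B) (op_ext B V W A)"
proof -
  let ?Y = "PiE V B" and ?Z = "PiE (W - V) B" and ?o = "\<lambda>z y. override_on z y V"
  obtain K where K: "K \<ge> 0" "\<And>f. f \<in> ell2 ?Y \<Longrightarrow> nsq ?Y (A f) \<le> K * nsq ?Y f"
    using bounded_op_bound[OF A] by blast
  note bij = bij_betw_override_on[OF VW, of B]
  have sl: "slice B V x \<Psi> \<in> ell2 ?Y" if "\<Psi> \<in> ell2 (PiE W B)" "x \<in> PiE W B" for x \<Psi>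
    using slice_ell2[OF VW] that by (simp add: hilb_def)
  have bnd: "op_ext B V W A \<Psi> \<in> ell2 (PiE W B) \<and> nsq (PiE W B) (op_ext B V W A \<Psi>) \<le> K * nsq (PiE W B) \<Psi>"
    if \<Psi>: "\<Psi> \<in> ell2 (PiE W B)" for \<Psi>
  \<comment> \<open>A base point \<open>z\<close> on \<open>W - V\<close> has to be completed by
    some assignment to \<open>V\<close> before \<open>sl\<close> applies. If there is none,
    \<open>PiE W B\<close> is empty too and nothing has to be summed.\<close>
  proof (cases "?Y = {}")
    case True
    then have "PiE W B = {}"
      using restrict_PiE_subset[OF VW] by blast
    then show ?thesis
      using \<Psi> by (auto simp: op_ext_def hilb_def ell2_def nsq_def)
  next
    case False
    \<comment> \<open>\<open>F\<close> and \<open>G\<close> are the squared moduli of the vector and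
      of its image on pairs of assignments; \<open>g\<close> and \<open>h\<close> are their inner
      sums over \<open>V\<close>.\<close>
    define F where "F = (\<lambda>(z, y). (cmod (\<Psi> (?o z y)))\<^sup>2)"
    define G where "G = (\<lambda>(z, y). (cmod (op_ext B V W A \<Psi> (?o z y)))\<^sup>2)"
    define g where "g = (\<lambda>z. nsq ?Y (slice B V z \<Psi>))"
    define h where "h = (\<lambda>z. nsq ?Y (A (slice B V z \<Psi>)))"
    have oW: "?o z y \<in> PiE W B" if "z \<in> ?Z" "y \<in> ?Y" for z y
      using bij that by (auto simp: bij_betw_def)
    have slz: "slice B V z \<Psi> \<in> ell2 ?Y" if z: "z \<in> ?Z" for z
    proof -
      obtain y where "y \<in> ?Y"
        using False by auto
      then show ?thesis
        using sl[OF \<Psi> oW[OF z]] by (simp add: slice_override_on)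
    qed
    have Fs: "F summable_on ?Z \<times> ?Y"
      using ell2_summable[OF \<Psi>] summable_on_reindex_bij_betw[OF bij, of "\<lambda>x. (cmod (\<Psi> x))\<^sup>2"]
      by (simp add: F_def case_prod_unfold)
    have Fi: "infsum F (?Z \<times> ?Y) = nsq (PiE W B) \<Psi>"
      using infsum_reindex_bij_betw[OF bij, of "\<lambda>x. (cmod (\<Psi> x))\<^sup>2"]
      by (simp add: F_def nsq_def case_prod_unfold)
    have Fg: "((\<lambda>y. F (z, y)) has_sum g z) ?Y" if "z \<in> ?Z" for z
    proof -
      have "((\<lambda>y. (cmod (slice B V z \<Psi> y))\<^sup>2) has_sum g z) ?Y"
        unfolding g_def nsq_def by (intro has_sum_infsum ell2_summable slz that)
      then show ?thesis
        by (rule has_sum_cong[THEN iffD1, rotated]) (simp add: F_def slice_def)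
    qed
    have gsum: "(g has_sum nsq (PiE W B) \<Psi>) ?Z"
      using has_sum_Sigma'[OF has_sum_infsum[OF Fs] Fg] by (simp add: Fi)
    have Gh: "((\<lambda>y. G (z, y)) has_sum h z) ?Y" if z: "z \<in> ?Z" for z
    proof -
      have "((\<lambda>y. (cmod (A (slice B V z \<Psi>) y))\<^sup>2) has_sum h z) ?Y"
        unfolding h_def nsq_def by (intro has_sum_infsum ell2_summable bounded_op_ell2[OF A] slz z)
      moreover have "G (z, y) = (cmod (A (slice B V z \<Psi>) y))\<^sup>2" if y: "y \<in> ?Y" for y
        using \<Psi> oW[OF z y] y
        by (simp add: G_def op_ext_apply hilb_def restrict_override_on slice_override_on)
      ultimately show ?thesis
        by (rule has_sum_cong[THEN iffD2, rotated])
    qed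
    have hg: "h z \<le> K * g z" if "z \<in> ?Z" for z
      unfolding h_def g_def by (intro K slz that)
    have Kg: "((\<lambda>z. K * g z) has_sum K * nsq (PiE W B) \<Psi>) ?Z"
      by (rule has_sum_cmult_right[OF gsum])
    have hs: "h summable_on ?Z"
      by (rule summable_on_comparison_test[OF has_sum_imp_summable[OF Kg] hg]) (auto simp: h_def nsq_nonneg)
    \<comment> \<open>For nonnegative terms, summability of the inner sums \<open>h\<close>, which
      comes from comparison with \<open>K * g\<close>, gives summability over the whole
      product.\<close>
    have Gs: "G summable_on ?Z \<times> ?Y"
      by (rule summable_on_SigmaI[OF Gh hs]) (auto simp: G_def)
    have "infsum G (?Z \<times> ?Y) \<le> K * nsq (PiE W B) \<Psi>"
    proof (rule has_sum_mono[OF _ Kg hg])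
      show "(h has_sum infsum G (?Z \<times> ?Y)) ?Z"
        by (rule has_sum_Sigma'[OF has_sum_infsum[OF Gs] Gh])
    qed
    moreover have "infsum G (?Z \<times> ?Y) = nsq (PiE W B) (op_ext B V W A \<Psi>)"
      using infsum_reindex_bij_betw[OF bij, of "\<lambda>x. (cmod (op_ext B V W A \<Psi> x))\<^sup>2"]
      by (simp add: G_def nsq_def case_prod_unfold)
    moreover have "(\<lambda>x. (cmod (op_ext B V W A \<Psi> x))\<^sup>2) summable_on PiE W B"
      using Gs summable_on_reindex_bij_betw[OF bij, of "\<lambda>x. (cmod (op_ext B V W A \<Psi> x))\<^sup>2"]
      by (simp add: G_def case_prod_unfold)
    ultimately show ?thesis
      using \<Psi> by (auto simp: ell2_def hilb_def op_ext_outside)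
  qed
  have "op_ext B V W A (\<lambda>x. \<Phi> x + \<Psi> x) = (\<lambda>x. op_ext B V W A \<Phi> x + op_ext B V W A \<Psi> x)"
    if "\<Phi> \<in> ell2 (PiE W B)" "\<Psi> \<in> ell2 (PiE W B)" for \<Phi> \<Psi>
  proof
    show "op_ext B V W A (\<lambda>x. \<Phi> x + \<Psi> x) x = op_ext B V W A \<Phi> x + op_ext B V W A \<Psi> x" for x
      using that by (cases "x \<in> PiE W B")
        (simp_all add: op_ext_apply op_ext_outside hilb_def ell2_add slice_add bounded_op_add[OF A] sl)
  qed
  moreover have "op_ext B V W A (\<lambda>x. a * \<Psi> x) = (\<lambda>x. a * op_ext B V W A \<Psi> x)"
    if "\<Psi> \<in> ell2 (PiE W B)" for \<Psi> a
  proof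
    show "op_ext B V W A (\<lambda>x. a * \<Psi> x) x = a * op_ext B V W A \<Psi> x" for x
      using that by (cases "x \<in> PiE W B")
        (simp_all add: op_ext_apply op_ext_outside hilb_def ell2_scale slice_scale bounded_op_scale[OF A] sl)
  qed
  ultimately show ?thesis
    unfolding bounded_op_def using bnd K(1) by blast
qed

text \<open>For an operator on \<open>V \<subseteq> U\<close> the variables outside \<open>U\<close>
  are mere parameters, so it does not matter whether they are fixed before or after it acts.\<close>

lemma slice_op_ext:
  assumes "V \<subseteq> U" and "U \<subseteq> W" and "\<Psi> \<in> hilb B W" and "x \<in> PiE W B"
  shows "slice B U x (op_ext B V W A \<Psi>) = op_ext B V U A (slice B U x \<Psi>)"
proof
  fix y
  have "slice B V (override_on x y U) \<Psi> = slice B V y (slice B U x \<Psi>)"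
    and "restrict (override_on x y U) V = restrict y V" if "y \<in> PiE U B"
    using that assms(1)
    by (auto simp: slice_def fun_eq_iff override_on_PiE override_on_def restrict_def intro!: arg_cong[of _ _ \<Psi>])
  then show "slice B U x (op_ext B V W A \<Psi>) y = op_ext B V U A (slice B U x \<Psi>) y"
    using assms slice_ell2[OF assms(2,3,4)]
    by (cases "y \<in> PiE U B") (simp_all add: slice_def[of B U x "op_ext B V W A \<Psi>"]
        op_ext_apply op_ext_outside override_on_PiE)
qed

text \<open>By \<open>slice_op_ext\<close> the left side is the \<open>U\<close>-slice at
  \<open>x\<close> of the one-step extension, read at the \<open>U\<close>-part of \<open>x\<close>
  itself; overriding \<open>x\<close> by its own part gives back \<open>x\<close>.\<close>

lemma op_ext_op_ext:
  assumes "V \<subseteq> U" and "U \<subseteq> W" and "\<Psi> \<in> hilb B W"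
  shows "op_ext B U W (op_ext B V U A) \<Psi> = op_ext B V W A \<Psi>"
proof
  fix x
  show "op_ext B U W (op_ext B V U A) \<Psi> x = op_ext B V W A \<Psi> x"
  proof (cases "x \<in> PiE W B")
    case True
    have "op_ext B U W (op_ext B V U A) \<Psi> x = slice B U x (op_ext B V W A \<Psi>) (restrict x U)"
      using True assms by (simp add: op_ext_apply slice_op_ext)
    also have "\<dots> = op_ext B V W A \<Psi> (override_on x (restrict x U) U)"
      using restrict_PiE_subset[OF assms(2) True] by (simp add: slice_def)
    also have "override_on x (restrict x U) U = x"
      by (auto simp: override_on_def)
    finally show ?thesis .
  qed (use assms in \<open>simp add: op_ext_outside\<close>)
qed

section \<open>Registers and circuits inside a larger space\<close>

lemma in_listset_iff: "bs \<in> listset As \<longleftrightarrow> list_all2 (\<in>) bs As"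
  by (induction As arbitrary: bs) (auto simp: set_Cons_def list_all2_Cons2)

lemma bij_betw_map_tuples:
  assumes "distinct qs"
  shows "bij_betw (\<lambda>y. map y qs) (PiE (set qs) B) (tuples B qs)"
proof (rule bij_betw_imageI)
  show "inj_on (\<lambda>y. map y qs) (PiE (set qs) B)"
    by (intro inj_onI PiE_ext) (auto simp: map_eq_conv)
  show "(\<lambda>y. map y qs) ` PiE (set qs) B = tuples B qs"
  proof (intro equalityI subsetI)
    fix bs assume "bs \<in> (\<lambda>y. map y qs) ` PiE (set qs) B"
    then show "bs \<in> tuples B qs"
      by (auto simp: in_listset_iff list_all2_map1 list_all2_map2 list.rel_refl_strong PiE_mem
          intro!: list_all2_refl)
  next
    fix bs assume bs: "bs \<in> tuples B qs"
    \<comment> \<open>The preimage looks each variable up in the tuple; as \<open>qs\<close> is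
      distinct, the lookup at \<open>qs ! i\<close> returns \<open>bs ! i\<close>.\<close>
    define y where "y = (\<lambda>v\<in>set qs. the (map_of (zip qs bs) v))"
    have len: "length qs = length bs" and mem: "\<And>i. i < length qs \<Longrightarrow> bs ! i \<in> B (qs ! i)"
      using bs by (auto simp: in_listset_iff list_all2_conv_all_nth)
    have yi: "y (qs ! i) = bs ! i" if "i < length qs" for i
      using that map_of_zip_nth[OF len assms, of i] len by (simp add: y_def)
    have "map y qs = bs"
      using len yi by (intro nth_equalityI) auto
    moreover have "y \<in> PiE (set qs) B"
      unfolding PiE_iff
    proof
      show "\<forall>v\<in>set qs. y v \<in> B v"
        using yi mem by (metis in_set_conv_nth)
    qed (simp add: y_def)
    ultimately show "bs \<in> (\<lambda>y. map y qs) ` PiE (set qs) B"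
      by blast
  qed
qed

text \<open>A bijection of label sets induces isometries both ways, \<open>T\<close> towards
  \<open>Y\<close> and composition with \<open>h\<close> back to \<open>X\<close>, so conjugation by
  them keeps the bound \<open>K\<close>.\<close>

lemma bounded_op_transport:
  assumes h: "bij_betw h X Y" and A: "bounded_op Y A"
  defines "T \<equiv> \<lambda>f b. if b \<in> Y then f (inv_into X h b) else 0"
  shows "bounded_op X (\<lambda>f x. if x \<in> X then A (T f) (h x) else 0)"
proof -
  have inv: "bij_betw (inv_into X h) Y X"
    by (rule bij_betw_inv_into[OF h])
  have T: "T f \<in> ell2 Y \<and> nsq Y (T f) = nsq X f" if f: "f \<in> ell2 X" for f
  proof -
    have "(\<lambda>b. (cmod (T f b))\<^sup>2) summable_on Y \<longleftrightarrow> (\<lambda>b. (cmod (f (inv_into X h b)))\<^sup>2) summable_on Y"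
      by (rule summable_on_cong) (simp add: T_def)
    also have "\<dots> \<longleftrightarrow> (\<lambda>x. (cmod (f x))\<^sup>2) summable_on X"
      by (rule summable_on_reindex_bij_betw[OF inv])
    finally have 1: "(\<lambda>b. (cmod (T f b))\<^sup>2) summable_on Y"
      using ell2_summable[OF f] by simp
    have "nsq Y (T f) = (\<Sum>\<^sub>\<infinity>b\<in>Y. (cmod (f (inv_into X h b)))\<^sup>2)"
      unfolding nsq_def by (rule infsum_cong) (simp add: T_def)
    also have "\<dots> = nsq X f"
      unfolding nsq_def by (rule infsum_reindex_bij_betw[OF inv])
    finally show ?thesis
      using 1 by (simp add: ell2_def T_def)
  qed
  have pull: "(\<lambda>x. if x \<in> X then g (h x) else 0) \<in> ell2 X \<and>
      nsq X (\<lambda>x. if x \<in> X then g (h x) else 0) = nsq Y g" if g: "g \<in> ell2 Y" for g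
  proof -
    have "(\<lambda>x. (cmod (if x \<in> X then g (h x) else 0))\<^sup>2) summable_on X \<longleftrightarrow>
        (\<lambda>x. (cmod (g (h x)))\<^sup>2) summable_on X"
      by (rule summable_on_cong) simp
    also have "\<dots> \<longleftrightarrow> (\<lambda>b. (cmod (g b))\<^sup>2) summable_on Y"
      by (rule summable_on_reindex_bij_betw[OF h])
    finally have 1: "(\<lambda>x. (cmod (if x \<in> X then g (h x) else 0))\<^sup>2) summable_on X"
      using ell2_summable[OF g] by simp
    have "nsq X (\<lambda>x. if x \<in> X then g (h x) else 0) = (\<Sum>\<^sub>\<infinity>x\<in>X. (cmod (g (h x)))\<^sup>2)"
      unfolding nsq_def by (rule infsum_cong) simp
    also have "\<dots> = nsq Y g"
      unfolding nsq_def by (rule infsum_reindex_bij_betw[OF h])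
    finally show ?thesis
      using 1 by (simp add: ell2_def)
  qed
  obtain K where K: "K \<ge> 0" "\<And>f. f \<in> ell2 Y \<Longrightarrow> nsq Y (A f) \<le> K * nsq Y f"
    using bounded_op_bound[OF A] by blast
  have Tadd: "T (\<lambda>x. f x + g x) = (\<lambda>b. T f b + T g b)" and Tscale: "T (\<lambda>x. a * f x) = (\<lambda>b. a * T f b)"
    for f g a
    by (auto simp: T_def)
  have TE: "T f \<in> ell2 Y" and Tn: "nsq Y (T f) = nsq X f" if "f \<in> ell2 X" for f
    using T[OF that] by auto
  have "nsq X (\<lambda>x. if x \<in> X then A (T f) (h x) else 0) \<le> K * nsq X f" if f: "f \<in> ell2 X" for f
    using K(2)[OF TE[OF f]] pull[OF bounded_op_ell2[OF A TE[OF f]]] Tn[OF f] by simp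
  moreover have "A (T (\<lambda>x. f x + g x)) = (\<lambda>b. A (T f) b + A (T g) b)" if "f \<in> ell2 X" "g \<in> ell2 X" for f g
    unfolding Tadd by (intro bounded_op_add[OF A] TE that)
  moreover have "A (T (\<lambda>x. a * f x)) = (\<lambda>b. a * A (T f) b)" if "f \<in> ell2 X" for f a
    unfolding Tscale by (intro bounded_op_scale[OF A] TE that)
  moreover have "(\<lambda>x. if x \<in> X then A (T f) (h x) else 0) \<in> ell2 X" if "f \<in> ell2 X" for f
    using pull[OF bounded_op_ell2[OF A TE[OF that]]] ..
  ultimately show ?thesis
    unfolding bounded_op_def
    by (intro conjI ballI allI exI[of _ K] K(1) ext) simp_all
qed

lemma bounded_on_reg:
  assumes "distinct qs" and "bounded_op (tuples B qs) A"
  shows "bounded_op (PiE (set qs) B) (on_reg B qs A)"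
  using bounded_op_transport[OF bij_betw_map_tuples[OF assms(1)] assms(2)]
  by (rule bounded_op_cong) (simp add: on_reg_def hilb_def)

section \<open>Circuit semantics on a common ambient space\<close>

definition reg_op :: "('v \<Rightarrow> 'b set) \<Rightarrow> 'v set \<Rightarrow> 'v list \<Rightarrow>
    (('b list \<Rightarrow> complex) \<Rightarrow> ('b list \<Rightarrow> complex)) \<Rightarrow>
    ((('v \<Rightarrow> 'b) \<Rightarrow> complex) \<Rightarrow> (('v \<Rightarrow> 'b) \<Rightarrow> complex))" where
  "reg_op B W qs A = op_ext B (set qs) W (on_reg B qs A)"

text \<open>For each law \<open>W\<close> is the set of all variables on either side, so that
  circuits with different variables become operators on one space and can be multiplied and added
  there.\<close>

definition sem_in :: "('v \<Rightarrow> 'b set) \<Rightarrow> 'v set \<Rightarrow> ('v, 'b) circuit \<Rightarrow>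
    ((('v \<Rightarrow> 'b) \<Rightarrow> complex) \<Rightarrow> (('v \<Rightarrow> 'b) \<Rightarrow> complex))" where
  "sem_in B W C = op_ext B (qv C) W (sem B C)"

lemma bounded_reg_op:
  assumes "distinct qs" and "set qs \<subseteq> W" and "bounded_op (tuples B qs) A"
  shows "bounded_op (PiE W B) (reg_op B W qs A)"
  unfolding reg_op_def by (intro bounded_op_ext bounded_on_reg assms)

lemma bounded_op_ketbra_onb:
  assumes "onb X \<psi>s" and "\<psi> \<in> set \<psi>s"
  shows "bounded_op X (ketbra X \<psi>)"
  using assms unfolding onb_def by (intro bounded_op_ketbra) blast

text \<open>Induction on the circuit: gates are unitary, and bounded operators are closed under
  extension, products and finite sums. Boundedness is what \<open>bounded_op_ext\<close> needs each
  time a part is extended to the variables of the whole.\<close>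

lemma bounded_sem:
  assumes "\<forall>U\<in>\<U>. unitary (listset (utype U)) (uop U)"
  shows "wf_circuit B \<U> C \<Longrightarrow> bounded_op (PiE (qv C) B) (sem B C)"
proof (induction C)
  case Skip
  show ?case
    using bounded_op_id by (rule bounded_op_cong) (simp add: hilb_def)
next
  case (Gate U qs)
  then have "distinct qs" and "bounded_op (tuples B qs) (uop U)"
    using assms bounded_op_unitary[of "listset (utype U)" "uop U"] by auto
  then show ?case
    by (simp add: bounded_on_reg)
next
  case (Seq C D)
  have C: "bounded_op (PiE (qv C \<union> qv D) B) (op_ext B (qv C) (qv C \<union> qv D) (sem B C))"
    and D: "bounded_op (PiE (qv C \<union> qv D) B) (op_ext B (qv D) (qv C \<union> qv D) (sem B D))"
    using Seq by (auto intro: bounded_op_ext)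
  show ?case
    by (rule bounded_op_cong[where A = "\<lambda>\<Psi>. op_ext B (qv D) (qv C \<union> qv D) (sem B D)
        (op_ext B (qv C) (qv C \<union> qv D) (sem B C) \<Psi>)"])
      (use bounded_op_comp[OF D C] in \<open>simp_all add: compose_def hilb_def\<close>)
next
  case (Qif qs bs)
  let ?V = "qv (Qif qs bs)"
  have "bounded_op (PiE ?V B) (\<lambda>\<Psi> x. \<Sum>p\<leftarrow>bs.
      reg_op B ?V qs (ketbra (tuples B qs) (fst p)) (sem_in B ?V (snd p) \<Psi>) x)"
  proof (rule bounded_op_sum_list)
    fix p assume p: "p \<in> set bs"
    have 1: "bounded_op (PiE ?V B) (reg_op B ?V qs (ketbra (tuples B qs) (fst p)))"
      using Qif.prems p by (intro bounded_reg_op bounded_op_ketbra_onb[of _ "map fst bs"]) auto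
    have 2: "bounded_op (PiE ?V B) (sem_in B ?V (snd p))"
      unfolding sem_in_def
    proof (rule bounded_op_ext)
      show "qv (snd p) \<subseteq> ?V"
        using p by fastforce
      show "bounded_op (PiE (qv (snd p)) B) (sem B (snd p))"
        using Qif.prems p by (intro Qif.IH[of p "snd p"]) (auto simp: snds.simps)
    qed
    show "bounded_op (PiE ?V B)
        (\<lambda>\<Psi>. reg_op B ?V qs (ketbra (tuples B qs) (fst p)) (sem_in B ?V (snd p) \<Psi>))"
      by (rule bounded_op_comp[OF 1 2])
  qed
  then show ?case
    by (rule bounded_op_cong) (simp add: hilb_def reg_op_def sem_in_def case_prod_unfold)
qed

lemma sem_in_hilb:
  assumes "\<forall>U\<in>\<U>. unitary (listset (utype U)) (uop U)" and "wf_circuit B \<U> C"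
    and "qv C \<subseteq> W" and "\<Psi> \<in> hilb B W"
  shows "sem_in B W C \<Psi> \<in> hilb B W"
  using bounded_op_ell2[OF bounded_op_ext[OF assms(3) bounded_sem[OF assms(1,2)]]] assms(4)
  by (simp add: sem_in_def hilb_def)

text \<open>Off the joint space both extended operators are \<open>undefined\<close>, so only its
  vectors have to be compared.\<close>

lemma circuit_equivI:
  assumes "\<And>\<Psi>. \<Psi> \<in> hilb B (qv C \<union> qv D) \<Longrightarrow>
    sem_in B (qv C \<union> qv D) C \<Psi> = sem_in B (qv C \<union> qv D) D \<Psi>"
  shows "circuit_equiv B C D"
  unfolding circuit_equiv_def
proof
  show "op_ext B (qv C) (qv C \<union> qv D) (sem B C) \<Psi> = op_ext B (qv D) (qv C \<union> qv D) (sem B D) \<Psi>" for \<Psi>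
    using assms[of \<Psi>] by (cases "\<Psi> \<in> hilb B (qv C \<union> qv D)") (simp_all add: sem_in_def op_ext_def)
qed

lemma sem_in_Gate: "sem_in B W (Gate U qs) = reg_op B W qs (uop U)"
  by (simp add: sem_in_def reg_op_def)

text \<open>The law (A A') \<otimes> I = (A \<otimes> I)(A' \<otimes> I) at one label
  \<open>x\<close>: the slice is pulled through \<open>A'\<close> by \<open>slice_op_ext\<close>,
  and \<open>op_ext_op_ext\<close> merges the two extensions of \<open>A\<close>.\<close>

lemma op_ext_comp:
  assumes "V \<subseteq> U" and "V' \<subseteq> U" and "U \<subseteq> W" and "\<Psi> \<in> hilb B W"
    and "op_ext B V' W A' \<Psi> \<in> hilb B W" and "x \<in> PiE W B"
  shows "op_ext B V U A (op_ext B V' U A' (slice B U x \<Psi>)) (restrict x U) =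
    op_ext B V W A (op_ext B V' W A' \<Psi>) x"
proof -
  have "op_ext B V U A (op_ext B V' U A' (slice B U x \<Psi>)) =
      op_ext B V U A (slice B U x (op_ext B V' W A' \<Psi>))"
    using assms by (simp add: slice_op_ext)
  then have "op_ext B V U A (op_ext B V' U A' (slice B U x \<Psi>)) (restrict x U) =
      op_ext B U W (op_ext B V U A) (op_ext B V' W A' \<Psi>) x"
    using assms by (simp add: op_ext_apply)
  then show ?thesis
    using assms by (simp add: op_ext_op_ext)
qed

text \<open>\<open>sem\<close> extends the parts only to the variables of the composite;
  \<open>op_ext_comp\<close> carries the product over to \<open>W\<close>. The intermediate vector
  has to lie in \<open>hilb B W\<close> because extended operators are \<open>undefined\<close>
  elsewhere.\<close>

lemma sem_in_Seq:
  assumes "qv C \<union> qv D \<subseteq> W" and "\<Psi> \<in> hilb B W" and "sem_in B W C \<Psi> \<in> hilb B W"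
  shows "sem_in B W (Seq C D) \<Psi> = sem_in B W D (sem_in B W C \<Psi>)"
proof
  let ?V = "qv C \<union> qv D"
  fix x
  show "sem_in B W (Seq C D) \<Psi> x = sem_in B W D (sem_in B W C \<Psi>) x"
  proof (cases "x \<in> PiE W B")
    case True
    then have "sem_in B W (Seq C D) \<Psi> x = op_ext B (qv D) ?V (sem B D)
        (op_ext B (qv C) ?V (sem B C) (slice B ?V x \<Psi>)) (restrict x ?V)"
      using assms slice_ell2[OF assms(1,2)] by (simp add: sem_in_def op_ext_apply compose_def)
    also have "\<dots> = sem_in B W D (sem_in B W C \<Psi>) x"
      using True assms unfolding sem_in_def by (intro op_ext_comp) auto
    finally show ?thesis .
  qed (use assms in \<open>simp add: sem_in_def op_ext_outside\<close>)
qed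

lemma sem_in_Qif:
  assumes "qv (Qif qs bs) \<subseteq> W" and "\<Psi> \<in> hilb B W"
    and "\<And>p. p \<in> set bs \<Longrightarrow> sem_in B W (snd p) \<Psi> \<in> hilb B W"
  shows "sem_in B W (Qif qs bs) \<Psi> =
    (\<lambda>x. \<Sum>p\<leftarrow>bs. reg_op B W qs (ketbra (tuples B qs) (fst p)) (sem_in B W (snd p) \<Psi>) x)"
proof
  let ?V = "qv (Qif qs bs)"
  fix x
  show "sem_in B W (Qif qs bs) \<Psi> x =
      (\<Sum>p\<leftarrow>bs. reg_op B W qs (ketbra (tuples B qs) (fst p)) (sem_in B W (snd p) \<Psi>) x)"
  proof (cases "x \<in> PiE W B")
    case True
    then have "sem_in B W (Qif qs bs) \<Psi> x = (\<Sum>p\<leftarrow>bs.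
        op_ext B (set qs) ?V (on_reg B qs (ketbra (tuples B qs) (fst p)))
          (op_ext B (qv (snd p)) ?V (sem B (snd p)) (slice B ?V x \<Psi>)) (restrict x ?V))"
      using assms slice_ell2[OF assms(1,2)]
      by (simp add: sem_in_def op_ext_apply case_prod_unfold del: qv.simps)
    also have "\<dots> = (\<Sum>p\<leftarrow>bs. reg_op B W qs (ketbra (tuples B qs) (fst p)) (sem_in B W (snd p) \<Psi>) x)"
    proof (intro arg_cong[of _ _ sum_list] map_cong refl)
      fix p assume p: "p \<in> set bs"
      then have "qv (snd p) \<subseteq> ?V"
        by fastforce
      then show "op_ext B (set qs) ?V (on_reg B qs (ketbra (tuples B qs) (fst p)))
          (op_ext B (qv (snd p)) ?V (sem B (snd p)) (slice B ?V x \<Psi>)) (restrict x ?V) =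
          reg_op B W qs (ketbra (tuples B qs) (fst p)) (sem_in B W (snd p) \<Psi>) x"
        using True assms(1,2) assms(3)[OF p] unfolding sem_in_def reg_op_def
        by (intro op_ext_comp) auto
    qed
    finally show ?thesis .
  next
    case False
    then have "(\<Sum>p\<leftarrow>bs. reg_op B W qs (ketbra (tuples B qs) (fst p)) (sem_in B W (snd p) \<Psi>) x) =
        (\<Sum>p\<leftarrow>bs. 0)"
      using assms(3) by (intro arg_cong[of _ _ sum_list] map_cong refl) (simp add: reg_op_def op_ext_outside)
    then show ?thesis
      using False assms(2) by (simp add: sem_in_def op_ext_outside)
  qed
qed

section \<open>Operators on qubits as finite sums\<close>

definition delta :: "'x \<Rightarrow> 'x \<Rightarrow> complex" where
  "delta y = (\<lambda>x. if x = y then 1 else 0)"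

lemma delta_ell2:
  assumes "x \<in> X"
  shows "delta x \<in> ell2 X"
proof -
  have "(\<lambda>y. (cmod (delta x y))\<^sup>2) summable_on X"
    by (rule finite_nonzero_values_imp_summable_on) (rule finite_subset[of _ "{x}"], auto simp: delta_def)
  then show ?thesis
    using assms by (auto simp: ell2_def delta_def)
qed

lemma
  assumes "x \<in> X"
  shows inner2_delta_left: "inner2 X (delta x) f = f x"
    and inner2_delta_right: "inner2 X f (delta x) = cnj (f x)"
  unfolding inner2_def using assms
  by (auto intro!: infsumI has_sum_finite_neutralI[of "{x}"] simp: delta_def split: if_splits)

text \<open>Since \<open>U\<close> is onto, \<open>g = U h\<close> for some \<open>h\<close>, and
  preservation of inner products makes \<open>h\<close> a solution of the defining equation of
  \<open>adj\<close>. Testing against standard basis vectors shows that it is the only one, so the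
  description is proper.\<close>

lemma inner2_adj:
  assumes U: "unitary X U" and g: "g \<in> ell2 X" and f: "f \<in> ell2 X"
  shows "inner2 X (U f) g = inner2 X f (adj X U g)"
proof -
  let ?P = "\<lambda>h. h \<in> ell2 X \<and> (\<forall>f\<in>ell2 X. inner2 X (U f) g = inner2 X f h)"
  have "g \<in> U ` ell2 X"
    using U g by (simp add: unitary_def bij_betw_def)
  then obtain h where h: "h \<in> ell2 X" "U h = g"
    by blast
  have "?P h"
    using U h unfolding unitary_def by blast
  moreover have "k = h" if k: "?P k" for k
  proof
    fix x
    show "k x = h x"
    proof (cases "x \<in> X")
      case True
      then have "inner2 X (delta x) k = inner2 X (delta x) h"
        using k \<open>?P h\<close> delta_ell2 by metis
      then show ?thesis
        using True by (simp add: inner2_delta_left)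
    next
      case False
      then show ?thesis
        using k h(1) by (metis ell2_outside)
    qed
  qed
  ultimately have the: "?P (THE h. ?P h)"
    by (rule theI)
  have adj: "adj X U g = (THE h. ?P h)"
    using g by (simp only: adj_def restrict_apply if_True)
  have "?P (adj X U g)"
    unfolding adj by (rule the)
  then show ?thesis
    using f by blast
qed

text \<open>Eliminates the inverse bijection of \<open>on_reg\<close>: the overridden assignment is
  determined by having the values \<open>bs\<close> on the register and those of \<open>x\<close>
  elsewhere. For one or two qubits \<open>upd\<close> will be a plain function update.\<close>

lemma reg_op_apply:
  assumes "distinct qs" and "set qs \<subseteq> W" and "\<Psi> \<in> hilb B W" and "x \<in> PiE W B"
    and upd: "\<And>bs. bs \<in> tuples B qs \<Longrightarrow> map (upd bs) qs = bs"
    and off: "\<And>bs v. bs \<in> tuples B qs \<Longrightarrow> v \<notin> set qs \<Longrightarrow> upd bs v = x v"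
  shows "reg_op B W qs A \<Psi> x =
    A (\<lambda>bs. if bs \<in> tuples B qs then \<Psi> (upd bs) else 0) (map x qs)"
proof -
  let ?inv = "inv_into (PiE (set qs) B) (\<lambda>y. map y qs)"
  note bij = bij_betw_map_tuples[OF assms(1), of B]
  have inv: "?inv bs \<in> PiE (set qs) B" "map (?inv bs) qs = bs" if "bs \<in> tuples B qs" for bs
    using bij that inv_into_into[of bs "\<lambda>y. map y qs" "PiE (set qs) B"]
      f_inv_into_f[of bs "\<lambda>y. map y qs" "PiE (set qs) B"]
    by (simp_all add: bij_betw_def)
  have "override_on x (?inv bs) (set qs) = upd bs" if bs: "bs \<in> tuples B qs" for bs
  proof
    have "map (?inv bs) qs = map (upd bs) qs"
      using inv(2)[OF bs] upd[OF bs] by simp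
    then show "override_on x (?inv bs) (set qs) v = upd bs v" for v
      using off[OF bs, of v] by (simp add: override_on_def)
  qed
  then have *: "(\<lambda>bs. if bs \<in> tuples B qs then slice B (set qs) x \<Psi> (?inv bs) else 0) =
      (\<lambda>bs. if bs \<in> tuples B qs then \<Psi> (upd bs) else 0)"
    using inv(1) by (auto simp: slice_def)
  have "reg_op B W qs A \<Psi> x =
      A (\<lambda>bs. if bs \<in> tuples B qs then slice B (set qs) x \<Psi> (?inv bs) else 0) (map (restrict x (set qs)) qs)"
    using assms slice_ell2[OF assms(2-4)] restrict_PiE_subset[OF assms(2,4)]
    unfolding reg_op_def by (simp only: op_ext_apply on_reg_def restrict_apply if_True simp_thms)
  also have "map (restrict x (set qs)) qs = map x qs"
    by simp
  finally show ?thesis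
    unfolding * .
qed

section \<open>Operators on one and two qubits as matrices\<close>

lemma tuples_single: "tuples B [q] = (\<lambda>b. [b]) ` B q"
  by (auto simp: set_Cons_def)

lemma tuples_pair: "tuples B [q1, q2] = (\<lambda>(b, c). [b, c]) ` (B q1 \<times> B q2)"
  by (auto simp: set_Cons_def)

text \<open>Here \<open>a c b\<close> is the entry in row \<open>c\<close> and column
  \<open>b\<close>, acting on the \<open>q\<close> coordinate only. Being a finite sum, it makes
  sense for every function \<open>\<Psi>\<close>, and its algebra below carries no membership
  conditions.\<close>

definition mat_op :: "('v \<Rightarrow> 'b set) \<Rightarrow> 'v set \<Rightarrow> 'v \<Rightarrow> ('b \<Rightarrow> 'b \<Rightarrow> complex) \<Rightarrow>
    ((('v \<Rightarrow> 'b) \<Rightarrow> complex) \<Rightarrow> (('v \<Rightarrow> 'b) \<Rightarrow> complex))" where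
  "mat_op B W q a \<Psi> = (\<lambda>x. if x \<in> PiE W B then \<Sum>b\<in>B q. a (x q) b * \<Psi> (x(q := b)) else 0)"

definition proj :: "('b list \<Rightarrow> complex) \<Rightarrow> 'b \<Rightarrow> 'b \<Rightarrow> complex" where
  "proj \<phi> c b = \<phi> [c] * cnj (\<phi> [b])"

lemma PiE_fun_upd:
  assumes "q \<in> W" and "x \<in> PiE W B" and "b \<in> B q"
  shows "x(q := b) \<in> PiE W B"
  using assms by (auto simp: PiE_iff extensional_def)

lemma inner2_single:
  assumes "finite (B q)"
  shows "inner2 (tuples B [q]) f g = (\<Sum>b\<in>B q. cnj (f [b]) * g [b])"
  using assms unfolding inner2_def tuples_single by (simp add: sum.reindex inj_on_def)

text \<open>Over a finite label set \<open>f\<close> is a finite combination of standard basis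
  vectors, and \<open>A\<close> is linear; the columns of its matrix are the images of these
  vectors.\<close>

lemma op_as_matrix:
  assumes fin: "finite (B q)" and A: "bounded_op (tuples B [q]) A"
    and f: "\<And>bs. bs \<notin> tuples B [q] \<Longrightarrow> f bs = 0"
  shows "A f bs = (\<Sum>b\<in>B q. f [b] * A (delta [b]) bs)"
proof -
  have "f = (\<lambda>bs. \<Sum>b\<in>B q. f [b] * delta [b] bs)"
  proof
    fix bs
    show "f bs = (\<Sum>b\<in>B q. f [b] * delta [b] bs)"
    proof (cases "bs \<in> tuples B [q]")
      case True
      then show ?thesis
        using fin by (auto simp: tuples_single delta_def if_distrib cong: if_cong)
    next
      case False
      then have "(\<Sum>b\<in>B q. f [b] * delta [b] bs) = 0"
        by (intro sum.neutral) (auto simp: tuples_single delta_def)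
      then show ?thesis
        using f[OF False] by simp
    qed
  qed
  then have "A f = A (\<lambda>bs. \<Sum>b\<in>B q. f [b] * delta [b] bs)"
    by simp
  also have "\<dots> = (\<lambda>bs. \<Sum>b\<in>B q. f [b] * A (delta [b]) bs)"
    by (rule bounded_op_sum[OF A fin delta_ell2]) (simp add: tuples_single)
  finally show ?thesis
    by simp
qed

lemma reg_op_single:
  assumes "finite (B q)" and "q \<in> W" and "bounded_op (tuples B [q]) A" and "\<Psi> \<in> hilb B W"
  shows "reg_op B W [q] A \<Psi> = mat_op B W q (\<lambda>c b. A (delta [b]) [c]) \<Psi>"
proof
  fix x
  show "reg_op B W [q] A \<Psi> x = mat_op B W q (\<lambda>c b. A (delta [b]) [c]) \<Psi> x"
  proof (cases "x \<in> PiE W B")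
    case True
    let ?f = "\<lambda>bs. if bs \<in> tuples B [q] then \<Psi> (x(q := hd bs)) else 0"
    have "reg_op B W [q] A \<Psi> x = A ?f (map x [q])"
      using True assms by (intro reg_op_apply) (auto simp: tuples_single)
    also have "\<dots> = (\<Sum>b\<in>B q. ?f [b] * A (delta [b]) (map x [q]))"
      using assms(1,3) by (rule op_as_matrix) simp
    also have "\<dots> = mat_op B W q (\<lambda>c b. A (delta [b]) [c]) \<Psi> x"
      using True by (simp add: mat_op_def tuples_single mult.commute)
    finally show ?thesis .
  qed (use assms in \<open>simp add: reg_op_def op_ext_outside mat_op_def\<close>)
qed

lemma mat_op_cong:
  assumes "q \<in> W" and "\<And>c b. c \<in> B q \<Longrightarrow> b \<in> B q \<Longrightarrow> a c b = a' c b"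
  shows "mat_op B W q a \<Psi> = mat_op B W q a' \<Psi>"
  using assms by (auto simp: mat_op_def fun_eq_iff PiE_iff intro!: sum.cong)

lemma reg_op_ketbra_single:
  assumes "finite (B q)" and "q \<in> W" and "\<phi> \<in> ell2 (tuples B [q])" and "\<Psi> \<in> hilb B W"
  shows "reg_op B W [q] (ketbra (tuples B [q]) \<phi>) \<Psi> = mat_op B W q (proj \<phi>) \<Psi>"
  unfolding reg_op_single[OF assms(1,2) bounded_op_ketbra[OF assms(3)] assms(4)]
proof (rule mat_op_cong[OF assms(2)])
  fix b c assume "b \<in> B q"
  then have "[b] \<in> tuples B [q]"
    by (simp add: tuples_single)
  then show "ketbra (tuples B [q]) \<phi> (delta [b]) [c] = proj \<phi> c b"
    by (simp add: ketbra_def proj_def delta_ell2 inner2_delta_right del: listset.simps list.map)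
qed

lemma mat_op_add: "mat_op B W q a (\<lambda>x. \<Phi> x + \<Psi> x) = (\<lambda>x. mat_op B W q a \<Phi> x + mat_op B W q a \<Psi> x)"
  by (auto simp: mat_op_def fun_eq_iff distrib_left sum.distrib)

text \<open>Setting \<open>q\<close> to \<open>b\<close> overwrites its earlier value
  \<open>d\<close>, so what remains is matrix multiplication.\<close>

lemma mat_op_mat_op:
  assumes "q \<in> W"
  shows "mat_op B W q a (mat_op B W q a' \<Psi>) = mat_op B W q (\<lambda>c b. \<Sum>d\<in>B q. a c d * a' d b) \<Psi>"
proof
  fix x
  show "mat_op B W q a (mat_op B W q a' \<Psi>) x = mat_op B W q (\<lambda>c b. \<Sum>d\<in>B q. a c d * a' d b) \<Psi> x"
  proof (cases "x \<in> PiE W B")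
    case True
    then have "mat_op B W q a (mat_op B W q a' \<Psi>) x =
        (\<Sum>d\<in>B q. \<Sum>b\<in>B q. a (x q) d * a' d b * \<Psi> (x(q := b)))"
      using assms by (simp add: mat_op_def PiE_fun_upd sum_distrib_left mult.assoc)
    also have "\<dots> = (\<Sum>b\<in>B q. \<Sum>d\<in>B q. a (x q) d * a' d b * \<Psi> (x(q := b)))"
      by (rule sum.swap)
    finally show ?thesis
      using True by (simp add: mat_op_def sum_distrib_right)
  qed (simp add: mat_op_def)
qed

text \<open>Updates of different variables commute, and so do the two finite sums.\<close>

lemma mat_op_commute:
  assumes "q1 \<in> W" and "q2 \<in> W" and "q1 \<noteq> q2"
  shows "mat_op B W q1 a (mat_op B W q2 a' \<Psi>) = mat_op B W q2 a' (mat_op B W q1 a \<Psi>)"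
proof
  fix x
  show "mat_op B W q1 a (mat_op B W q2 a' \<Psi>) x = mat_op B W q2 a' (mat_op B W q1 a \<Psi>) x"
  proof (cases "x \<in> PiE W B")
    case True
    then have "mat_op B W q1 a (mat_op B W q2 a' \<Psi>) x =
        (\<Sum>b\<in>B q1. \<Sum>c\<in>B q2. a (x q1) b * (a' (x q2) c * \<Psi> (x(q1 := b, q2 := c))))"
      using assms by (simp add: mat_op_def PiE_fun_upd sum_distrib_left)
    also have "\<dots> = (\<Sum>c\<in>B q2. \<Sum>b\<in>B q1. a (x q1) b * (a' (x q2) c * \<Psi> (x(q1 := b, q2 := c))))"
      by (rule sum.swap)
    also have "\<dots> = (\<Sum>c\<in>B q2. \<Sum>b\<in>B q1. a' (x q2) c * (a (x q1) b * \<Psi> (x(q2 := c, q1 := b))))"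
      using assms by (simp add: fun_upd_twist mult.left_commute)
    finally show ?thesis
      using True assms by (simp add: mat_op_def PiE_fun_upd sum_distrib_left)
  qed (simp add: mat_op_def)
qed

text \<open>Expand the standard basis vector of \<open>b\<close> in the given basis. Orthonormality
  identifies the coefficients as the conjugated \<open>b\<close>-components of the basis vectors,
  and reading the expansion at \<open>c\<close> gives the entry of the identity matrix.\<close>

lemma onb_pair_completeness:
  assumes onb: "onb (tuples B [q]) [\<phi>0, \<phi>1]" and b: "b \<in> B q"
  shows "proj \<phi>0 c b + proj \<phi>1 c b = (if c = b then 1 else 0)"
proof -
  let ?X = "tuples B [q]"
  have bX: "[b] \<in> ?X"
    using b by (simp add: tuples_single)
  note d = delta_ell2[OF bX]
  have mem: "\<phi>0 \<in> ell2 ?X" "\<phi>1 \<in> ell2 ?X"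
    using onb by (auto simp: onb_def simp del: listset.simps list.map)
  have orth: "inner2 ?X ([\<phi>0, \<phi>1] ! i) ([\<phi>0, \<phi>1] ! j) = (if i = j then 1 else 0)" if "i < 2" "j < 2" for i j
    using onb that by (simp add: onb_def del: listset.simps list.map)
  have orth': "inner2 ?X \<phi>0 \<phi>0 = 1" "inner2 ?X \<phi>0 \<phi>1 = 0" "inner2 ?X \<phi>1 \<phi>0 = 0" "inner2 ?X \<phi>1 \<phi>1 = 1"
    using orth[of 0 0] orth[of 0 1] orth[of 1 0] orth[of 1 1] by (simp_all del: listset.simps list.map)
  obtain k where "delta [b] = (\<lambda>x. \<Sum>i<length [\<phi>0, \<phi>1]. k i * ([\<phi>0, \<phi>1] ! i) x)"
    using onb d unfolding onb_def by blast
  then have k: "delta [b] = (\<lambda>x. k 0 * \<phi>0 x + k 1 * \<phi>1 x)"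
    by (simp add: numeral_2_eq_2)
  have coord: "cnj (\<phi> [b]) = k 0 * inner2 ?X \<phi> \<phi>0 + k 1 * inner2 ?X \<phi> \<phi>1" if "\<phi> \<in> ell2 ?X" for \<phi>
    using inner2_delta_right[OF bX, of \<phi>]
    by (simp only: k inner2_add_right[OF that mem[THEN ell2_scale]] inner2_scale_right)
  have "cnj (\<phi>0 [b]) = k 0" "cnj (\<phi>1 [b]) = k 1"
    using mem[THEN coord] by (simp_all add: orth' del: listset.simps list.map)
  then have "proj \<phi>0 c b + proj \<phi>1 c b = delta [b] [c]"
    by (simp add: proj_def k mult.commute)
  then show ?thesis
    by (simp add: delta_def)
qed

lemma mat_op_proj_sum:
  assumes fin: "finite (B q)" and "q \<in> W" and onb: "onb (tuples B [q]) [\<phi>0, \<phi>1]" and "\<Psi> \<in> hilb B W"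
  shows "(\<lambda>x. mat_op B W q (proj \<phi>0) \<Psi> x + mat_op B W q (proj \<phi>1) \<Psi> x) = \<Psi>"
proof
  fix x
  show "mat_op B W q (proj \<phi>0) \<Psi> x + mat_op B W q (proj \<phi>1) \<Psi> x = \<Psi> x"
  proof (cases "x \<in> PiE W B")
    case True
    then have "mat_op B W q (proj \<phi>0) \<Psi> x + mat_op B W q (proj \<phi>1) \<Psi> x =
        (\<Sum>b\<in>B q. (proj \<phi>0 (x q) b + proj \<phi>1 (x q) b) * \<Psi> (x(q := b)))"
      by (simp add: mat_op_def sum.distrib distrib_right)
    also have "\<dots> = (\<Sum>b\<in>B q. if x q = b then \<Psi> (x(q := b)) else 0)"
      by (intro sum.cong refl) (simp add: onb_pair_completeness[OF onb])
    also have "\<dots> = \<Psi> x"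
      using fin True assms(2) by (auto simp: PiE_iff)
    finally show ?thesis .
  next
    case False
    then show ?thesis
      using assms(4) by (simp add: mat_op_def hilb_def ell2_outside)
  qed
qed

text \<open>The projector onto a product vector has products of the single-qubit entries as its
  entries, so its double sum is the two matrix actions carried out one after the other.\<close>

lemma reg_op_ketbra_pair:
  assumes fin: "finite (B q1)" "finite (B q2)" and q: "q1 \<in> W" "q2 \<in> W" "q1 \<noteq> q2"
    and \<Psi>: "\<Psi> \<in> hilb B W"
  shows "reg_op B W [q1, q2] (ketbra (tuples B [q1, q2]) (ket_tensor \<phi> \<xi>)) \<Psi> =
    mat_op B W q1 (proj \<phi>) (mat_op B W q2 (proj \<xi>) \<Psi>)"
proof
  fix x
  show "reg_op B W [q1, q2] (ketbra (tuples B [q1, q2]) (ket_tensor \<phi> \<xi>)) \<Psi> x =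
      mat_op B W q1 (proj \<phi>) (mat_op B W q2 (proj \<xi>) \<Psi>) x"
  proof (cases "x \<in> PiE W B")
    case True
    let ?X = "tuples B [q1, q2]" and ?k = "ket_tensor \<phi> \<xi>"
    let ?f = "\<lambda>bs. if bs \<in> ?X then \<Psi> (x(q1 := bs ! 0, q2 := bs ! 1)) else 0"
    have X: "finite ?X"
      using fin by (simp only: tuples_pair finite_imageI finite_cartesian_product)
    have f: "?f \<in> ell2 ?X"
      by (rule ell2_finite[OF X]) simp
    have "inner2 ?X ?k ?f = (\<Sum>bs\<in>?X. cnj (?k bs) * ?f bs)"
      using X by (simp add: inner2_def del: listset.simps list.map)
    also have "\<dots> = (\<Sum>p\<in>B q1 \<times> B q2. cnj (?k [fst p, snd p]) * ?f [fst p, snd p])"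
      unfolding tuples_pair by (subst sum.reindex) (auto simp: inj_on_def case_prod_unfold)
    also have "\<dots> = (\<Sum>p\<in>B q1 \<times> B q2. cnj (\<phi> [fst p]) * cnj (\<xi> [snd p]) * \<Psi> (x(q1 := fst p, q2 := snd p)))"
      by (intro sum.cong refl) (auto simp: tuples_pair ket_tensor_def simp del: listset.simps list.map)
    also have "\<dots> = (\<Sum>b\<in>B q1. \<Sum>c\<in>B q2. cnj (\<phi> [b]) * cnj (\<xi> [c]) * \<Psi> (x(q1 := b, q2 := c)))"
      by (simp add: sum.cartesian_product case_prod_unfold)
    finally have inner: "inner2 ?X ?k ?f = \<dots>" .
    have "reg_op B W [q1, q2] (ketbra ?X ?k) \<Psi> x = ketbra ?X ?k ?f (map x [q1, q2])"
      using True q \<Psi> by (intro reg_op_apply, unfold tuples_pair) auto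
    also have "\<dots> = inner2 ?X ?k ?f * (\<phi> [x q1] * \<xi> [x q2])"
    proof -
      have "map x [q1, q2] = [x q1, x q2]" and "?k [x q1, x q2] = \<phi> [x q1] * \<xi> [x q2]"
        by (simp_all add: ket_tensor_def)
      then show ?thesis
        using f by (simp only: ketbra_def restrict_apply if_True)
    qed
    also have "\<dots> = mat_op B W q1 (proj \<phi>) (mat_op B W q2 (proj \<xi>) \<Psi>) x"
      unfolding inner using True q
      by (simp add: mat_op_def PiE_fun_upd proj_def sum_distrib_left sum_distrib_right mult_ac)
    finally show ?thesis .
  qed (use \<Psi> in \<open>simp add: reg_op_def op_ext_outside mat_op_def\<close>)
qed

text \<open>As \<open>q\<close> lies outside \<open>V\<close>, a slice of the transformed vector is
  a finite combination of slices at the points \<open>x(q := b)\<close>. Linearity moves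
  \<open>A\<close> inside, and restriction to \<open>V\<close> does not notice the update of
  \<open>q\<close>.\<close>

lemma op_ext_mat_op_commute:
  assumes fin: "finite (B q)" and q: "q \<in> W" "q \<notin> V" and VW: "V \<subseteq> W"
    and A: "bounded_op (PiE V B) A" and \<Psi>: "\<Psi> \<in> hilb B W" and m: "mat_op B W q a \<Psi> \<in> hilb B W"
  shows "op_ext B V W A (mat_op B W q a \<Psi>) = mat_op B W q a (op_ext B V W A \<Psi>)"
proof
  fix x
  show "op_ext B V W A (mat_op B W q a \<Psi>) x = mat_op B W q a (op_ext B V W A \<Psi>) x"
  proof (cases "x \<in> PiE W B")
    case True
    have upd: "override_on x y V q = x q" "(override_on x y V)(q := b) = override_on (x(q := b)) y V" for y b
      using q(2) by (auto simp: override_on_def fun_eq_iff)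
    have "slice B V x (mat_op B W q a \<Psi>) = (\<lambda>y. \<Sum>b\<in>B q. a (x q) b * slice B V (x(q := b)) \<Psi> y)"
      using True by (auto simp: slice_def mat_op_def fun_eq_iff upd override_on_PiE[OF VW])
    then have "op_ext B V W A (mat_op B W q a \<Psi>) x =
        A (\<lambda>y. \<Sum>b\<in>B q. a (x q) b * slice B V (x(q := b)) \<Psi> y) (restrict x V)"
      using True m by (simp add: op_ext_apply)
    also have "\<dots> = (\<Sum>b\<in>B q. a (x q) b * A (slice B V (x(q := b)) \<Psi>) (restrict x V))"
      using slice_ell2[OF VW \<Psi> PiE_fun_upd[OF q(1) True]]
      by (subst bounded_op_sum[OF A fin]) (simp_all add: hilb_def)
    also have "\<dots> = (\<Sum>b\<in>B q. a (x q) b * op_ext B V W A \<Psi> (x(q := b)))"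
    proof (intro sum.cong refl)
      fix b assume b: "b \<in> B q"
      have "restrict (x(q := b)) V = restrict x V"
        using q(2) by (auto simp: restrict_def)
      then show "a (x q) b * A (slice B V (x(q := b)) \<Psi>) (restrict x V) =
          a (x q) b * op_ext B V W A \<Psi> (x(q := b))"
        using \<Psi> PiE_fun_upd[OF q(1) True b] by (simp add: op_ext_apply)
    qed
    finally show ?thesis
      using True by (simp add: mat_op_def)
  qed (use m in \<open>simp add: op_ext_outside mat_op_def\<close>)
qed

text \<open>Conjugating the projector onto \<open>\<phi>\<close> by \<open>U\<close> gives the
  projector onto \<open>U \<phi>\<close>, and the phase drops out because it meets its own
  conjugate.\<close>

lemma mat_op_conj:
  assumes fin: "finite (B q)" and q: "q \<in> W" and U: "unitary (tuples B [q]) U"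
    and \<phi>: "\<phi> \<in> ell2 (tuples B [q])" and U\<phi>: "U \<phi> = (\<lambda>x. \<alpha> * \<psi> x)" and "cmod \<alpha> = 1"
  shows "mat_op B W q (\<lambda>c b. U (delta [b]) [c]) (mat_op B W q (proj \<phi>)
      (mat_op B W q (\<lambda>c b. adj (tuples B [q]) U (delta [b]) [c]) \<Psi>)) = mat_op B W q (proj \<psi>) \<Psi>"
  unfolding mat_op_mat_op[OF q]
proof (rule mat_op_cong[OF q])
  let ?X = "tuples B [q]"
  fix c b assume "c \<in> B q" and "b \<in> B q"
  then have b: "[b] \<in> ?X"
    by (simp add: tuples_single)
  \<comment> \<open>\<open>left\<close> is a component of the ket \<open>U \<phi>\<close>;
    \<open>right\<close> is a component of the corresponding bra, for which the adjoint is moved to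
    the other side of the inner product.\<close>
  have left: "(\<Sum>d\<in>B q. U (delta [d]) [c] * \<phi> [d]) = \<alpha> * \<psi> [c]"
    using op_as_matrix[where B = B and q = q and f = \<phi> and bs = "[c]", OF fin bounded_op_unitary[OF U] ell2_outside[OF \<phi>]] U\<phi>
    by (simp add: mult.commute)
  have "(\<Sum>e\<in>B q. cnj (\<phi> [e]) * adj ?X U (delta [b]) [e]) = inner2 ?X \<phi> (adj ?X U (delta [b]))"
    by (rule inner2_single[where B = B and q = q, OF fin, symmetric])
  also have "\<dots> = inner2 ?X (U \<phi>) (delta [b])"
    by (rule inner2_adj[OF U delta_ell2[OF b] \<phi>, symmetric])
  also have "\<dots> = cnj (\<alpha> * \<psi> [b])"
    using inner2_delta_right[OF b, of "U \<phi>"] by (simp only: U\<phi>)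
  finally have right: "(\<Sum>e\<in>B q. cnj (\<phi> [e]) * adj ?X U (delta [b]) [e]) = cnj (\<alpha> * \<psi> [b])" .
  \<comment> \<open>The entries of a rank-one matrix factor, so the double sum splits into
    \<open>left\<close> times \<open>right\<close>.\<close>
  have "(\<Sum>d\<in>B q. U (delta [d]) [c] * (\<Sum>e\<in>B q. proj \<phi> d e * adj ?X U (delta [b]) [e])) =
      (\<Sum>d\<in>B q. U (delta [d]) [c] * \<phi> [d]) * (\<Sum>e\<in>B q. cnj (\<phi> [e]) * adj ?X U (delta [b]) [e])"
    unfolding sum_distrib_right proj_def
    by (intro sum.cong refl) (simp only: sum_distrib_left mult.assoc)
  also have "\<dots> = (\<alpha> * cnj \<alpha>) * (\<psi> [c] * cnj (\<psi> [b]))"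
    unfolding left right by simp
  also have "\<alpha> * cnj \<alpha> = 1"
    using complex_norm_square[of \<alpha>] \<open>cmod \<alpha> = 1\<close> by simp
  finally show "(\<Sum>d\<in>B q. U (delta [d]) [c] * (\<Sum>e\<in>B q. proj \<phi> d e * adj ?X U (delta [b]) [e])) =
      proj \<psi> c b"
    by (simp add: proj_def)
qed

section \<open>The circuit laws\<close>

lemma finite_qubit: "qubit B q \<Longrightarrow> finite (B q)"
  unfolding qubit_def by (rule card_ge_0_finite) simp

lemma qv_branch: "qv (branch C0 \<phi>0 q \<phi>1 C1) = {q} \<union> qv C0 \<union> qv C1"
  by (auto simp: branch_def)

lemma wf_branch:
  "wf_circuit B \<U> (branch C0 \<phi>0 q \<phi>1 C1) \<longleftrightarrow>
    onb (tuples B [q]) [\<phi>0, \<phi>1] \<and> wf_circuit B \<U> C0 \<and> wf_circuit B \<U> C1 \<and> q \<notin> qv C0 \<and> q \<notin> qv C1"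
  by (auto simp: branch_def)

lemma onb_ell2: "onb X \<psi>s \<Longrightarrow> \<psi> \<in> set \<psi>s \<Longrightarrow> \<psi> \<in> ell2 X"
  unfolding onb_def by blast

context
  fixes B :: "'v \<Rightarrow> 'b set" and \<U> :: "'b uconst set"
  assumes unit: "\<forall>U\<in>\<U>. unitary (listset (utype U)) (uop U)"
begin

text \<open>The form P0 E0 + P1 E1 on which every law below is computed, with the projectors as
  explicit matrices.\<close>

lemma sem_in_branch:
  assumes q: "qubit B q" and wf: "wf_circuit B \<U> (branch C0 \<phi>0 q \<phi>1 C1)"
    and W: "qv (branch C0 \<phi>0 q \<phi>1 C1) \<subseteq> W" and \<Psi>: "\<Psi> \<in> hilb B W"
  shows "sem_in B W (branch C0 \<phi>0 q \<phi>1 C1) \<Psi> =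
    (\<lambda>x. mat_op B W q (proj \<phi>0) (sem_in B W C0 \<Psi>) x + mat_op B W q (proj \<phi>1) (sem_in B W C1 \<Psi>) x)"
proof -
  have E: "sem_in B W C0 \<Psi> \<in> hilb B W" "sem_in B W C1 \<Psi> \<in> hilb B W"
    using wf W \<Psi> by (auto simp: wf_branch qv_branch intro!: sem_in_hilb[OF unit])
  have mem: "\<phi>0 \<in> ell2 (tuples B [q])" "\<phi>1 \<in> ell2 (tuples B [q])" and "q \<in> W"
    using wf W unfolding wf_branch qv_branch by (auto intro: onb_ell2 simp del: listset.simps list.map)
  note P = reg_op_ketbra_single[where B = B and q = q, OF finite_qubit[OF q] \<open>q \<in> W\<close>]
  have "sem_in B W (branch C0 \<phi>0 q \<phi>1 C1) \<Psi> = (\<lambda>x. \<Sum>p\<leftarrow>[(\<phi>0, C0), (\<phi>1, C1)].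
      reg_op B W [q] (ketbra (tuples B [q]) (fst p)) (sem_in B W (snd p) \<Psi>) x)"
    unfolding branch_def by (rule sem_in_Qif) (use W \<Psi> E in \<open>auto simp: branch_def\<close>)
  then show ?thesis
    by (simp only: P[OF mem(1) E(1), unfolded list.map] P[OF mem(2) E(2), unfolded list.map] list.map fst_conv snd_conv sum_list.Cons
        sum_list.Nil add_0_right)
qed

text \<open>On the common space the sequence is U (P0 E0 + P1 E1) V with V the adjoint of U. V
  commutes with E0 and E1, which do not act on \<open>q\<close>, and \<open>mat_op_conj\<close> then
  evaluates each U Pi V.\<close>

lemma branch_change_basis:
  assumes q: "qubit B q" and on\<phi>: "onb (tuples B [q]) [\<phi>0, \<phi>1]"
    and \<alpha>: "cmod \<alpha>0 = 1" "cmod \<alpha>1 = 1"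
    and U: "uop U \<phi>0 = (\<lambda>x. \<alpha>0 * \<psi>0 x)" "uop U \<phi>1 = (\<lambda>x. \<alpha>1 * \<psi>1 x)"
    and wf: "wf_circuit B \<U> (branch C0 \<psi>0 q \<psi>1 C1)"
    and wfS: "wf_circuit B \<U> (Seq (Seq (Gate (dagger U) [q]) (branch C0 \<phi>0 q \<phi>1 C1)) (Gate U [q]))"
  shows "circuit_equiv B (branch C0 \<psi>0 q \<psi>1 C1)
    (Seq (Seq (Gate (dagger U) [q]) (branch C0 \<phi>0 q \<phi>1 C1)) (Gate U [q]))"
proof (rule circuit_equivI)
  let ?br = "branch C0 \<phi>0 q \<phi>1 C1" and ?D = "Gate (dagger U) [q]" and ?G = "Gate U [q]"
  let ?W = "qv (branch C0 \<psi>0 q \<psi>1 C1) \<union> qv (Seq (Seq ?D ?br) ?G)"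
  let ?X = "tuples B [q]"
  fix \<Psi> assume \<Psi>: "\<Psi> \<in> hilb B ?W"
  note fin = finite_qubit[OF q]
  have qW: "q \<in> ?W" and sub: "qv C0 \<subseteq> ?W" "qv C1 \<subseteq> ?W" "qv ?br \<subseteq> ?W"
    by (auto simp: qv_branch)
  have mem: "\<phi>0 \<in> ell2 ?X" "\<phi>1 \<in> ell2 ?X"
    by (simp_all add: onb_ell2[OF on\<phi>] del: listset.simps list.map)
  have wfC: "wf_circuit B \<U> C0" "wf_circuit B \<U> C1" "q \<notin> qv C0" "q \<notin> qv C1"
    using wf by (simp_all add: wf_branch)
  have wfs: "wf_circuit B \<U> (Seq ?D ?br)" "wf_circuit B \<U> ?br" "wf_circuit B \<U> ?D" "wf_circuit B \<U> ?G"
    using wfS by simp_all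
  \<comment> \<open>Well-formedness of the first gate puts \<open>dagger U\<close> among the
    constants, which makes the adjoint unitary as well.\<close>
  have ty: "listset (utype U) = ?X" and un: "unitary ?X (uop U)" "unitary ?X (adj ?X (uop U))"
    using wfs(3,4) unit by (auto simp: dagger_def)
  have dag: "uop (dagger U) = adj ?X (uop U)"
    unfolding dagger_def uconst.sel ty ..
  let ?u = "\<lambda>c b. uop U (delta [b]) [c]" and ?v = "\<lambda>c b. adj ?X (uop U) (delta [b]) [c]"
  have G: "sem_in B ?W ?G \<Phi> = mat_op B ?W q ?u \<Phi>" if "\<Phi> \<in> hilb B ?W" for \<Phi>
    unfolding sem_in_Gate by (rule reg_op_single[OF fin qW bounded_op_unitary[OF un(1)] that])
  have D: "sem_in B ?W ?D \<Psi> = mat_op B ?W q ?v \<Psi>"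
    unfolding sem_in_Gate dag
    by (rule reg_op_single[OF fin qW bounded_op_unitary[OF un(2)] \<Psi>])
  have DH: "sem_in B ?W ?D \<Psi> \<in> hilb B ?W"
    using wfs(3) \<Psi> by (intro sem_in_hilb[OF unit]) auto
  have comm: "sem_in B ?W C (mat_op B ?W q ?v \<Psi>) = mat_op B ?W q ?v (sem_in B ?W C \<Psi>)"
    if "wf_circuit B \<U> C" "qv C \<subseteq> ?W" "q \<notin> qv C" for C
    unfolding sem_in_def
    by (rule op_ext_mat_op_commute[OF fin qW that(3,2) bounded_sem[OF unit that(1)] \<Psi> DH[unfolded D]])
  have SD: "sem_in B ?W (Seq ?D ?br) \<Psi> = sem_in B ?W ?br (mat_op B ?W q ?v \<Psi>)"
    unfolding D[symmetric] by (rule sem_in_Seq[OF _ \<Psi> DH]) auto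
  have SDH: "sem_in B ?W (Seq ?D ?br) \<Psi> \<in> hilb B ?W"
    using wfs(1) \<Psi> by (intro sem_in_hilb[OF unit]) auto
  have "sem_in B ?W (Seq (Seq ?D ?br) ?G) \<Psi> = mat_op B ?W q ?u (sem_in B ?W (Seq ?D ?br) \<Psi>)"
    unfolding G[OF SDH, symmetric] by (rule sem_in_Seq[OF _ \<Psi> SDH]) auto
  also have "\<dots> = mat_op B ?W q ?u (\<lambda>x.
      mat_op B ?W q (proj \<phi>0) (mat_op B ?W q ?v (sem_in B ?W C0 \<Psi>)) x +
      mat_op B ?W q (proj \<phi>1) (mat_op B ?W q ?v (sem_in B ?W C1 \<Psi>)) x)"
    unfolding SD sem_in_branch[OF q wfs(2) sub(3) DH[unfolded D]]
      comm[OF wfC(1) sub(1) wfC(3)] comm[OF wfC(2) sub(2) wfC(4)] ..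
  also have "\<dots> = (\<lambda>x. mat_op B ?W q (proj \<psi>0) (sem_in B ?W C0 \<Psi>) x +
      mat_op B ?W q (proj \<psi>1) (sem_in B ?W C1 \<Psi>) x)"
    unfolding mat_op_add mat_op_conj[OF fin qW un(1) mem(1) U(1) \<alpha>(1)]
      mat_op_conj[OF fin qW un(1) mem(2) U(2) \<alpha>(2)] ..
  also have "\<dots> = sem_in B ?W (branch C0 \<psi>0 q \<psi>1 C1) \<Psi>"
    by (rule sem_in_branch[OF q wf _ \<Psi>, symmetric]) blast
  finally show "sem_in B ?W (branch C0 \<psi>0 q \<psi>1 C1) \<Psi> = sem_in B ?W (Seq (Seq ?D ?br) ?G) \<Psi>"
    by (rule sym)
qed

lemma branch_symmetry:
  assumes q: "qubit B q" and wf: "wf_circuit B \<U> (branch C0 \<phi>0 q \<phi>1 C1)"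
    and wf': "wf_circuit B \<U> (branch C1 \<phi>1 q \<phi>0 C0)"
  shows "circuit_equiv B (branch C0 \<phi>0 q \<phi>1 C1) (branch C1 \<phi>1 q \<phi>0 C0)"
proof (rule circuit_equivI)
  let ?W = "qv (branch C0 \<phi>0 q \<phi>1 C1) \<union> qv (branch C1 \<phi>1 q \<phi>0 C0)"
  fix \<Psi> assume \<Psi>: "\<Psi> \<in> hilb B ?W"
  show "sem_in B ?W (branch C0 \<phi>0 q \<phi>1 C1) \<Psi> = sem_in B ?W (branch C1 \<phi>1 q \<phi>0 C0) \<Psi>"
    unfolding sem_in_branch[OF q wf Un_upper1 \<Psi>] sem_in_branch[OF q wf' Un_upper2 \<Psi>]
    by (simp add: add.commute)
qed

text \<open>With equal branches the normal form is (P0 + P1) E, and the projectors sum to the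
  identity.\<close>

lemma branch_idempotence:
  assumes q: "qubit B q" and wf: "wf_circuit B \<U> (branch C \<phi>0 q \<phi>1 C)"
  shows "circuit_equiv B (branch C \<phi>0 q \<phi>1 C) C"
proof (rule circuit_equivI)
  let ?W = "qv (branch C \<phi>0 q \<phi>1 C) \<union> qv C"
  fix \<Psi> assume \<Psi>: "\<Psi> \<in> hilb B ?W"
  have "q \<in> ?W"
    by (simp add: qv_branch)
  moreover have "onb (tuples B [q]) [\<phi>0, \<phi>1]" and "wf_circuit B \<U> C"
    using wf unfolding wf_branch by blast+
  moreover from this have "sem_in B ?W C \<Psi> \<in> hilb B ?W"
    using \<Psi> by (intro sem_in_hilb[OF unit]) auto
  ultimately show "sem_in B ?W (branch C \<phi>0 q \<phi>1 C) \<Psi> = sem_in B ?W C \<Psi>"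
    unfolding sem_in_branch[OF q wf Un_upper1 \<Psi>] by (intro mat_op_proj_sum finite_qubit[OF q])
qed

text \<open>With Pi on \<open>q1\<close> and Qj on \<open>q2\<close>, the right side is Q0 (P0 E +
  P1 E0) + Q1 (P0 E + P1 E1). After commuting the projectors and regrouping, the terms with E
  combine to P0 (Q0 + Q1) E = P0 E, as on the left.\<close>

lemma branch_distributivity:
  assumes q: "qubit B q1" "qubit B q2" "q1 \<noteq> q2"
    and wf: "wf_circuit B \<U> (branch C \<phi>0 q1 \<phi>1 (branch C0 \<xi>0 q2 \<xi>1 C1))"
    and wf': "wf_circuit B \<U> (branch (branch C \<phi>0 q1 \<phi>1 C0) \<xi>0 q2 \<xi>1 (branch C \<phi>0 q1 \<phi>1 C1))"
  shows "circuit_equiv B (branch C \<phi>0 q1 \<phi>1 (branch C0 \<xi>0 q2 \<xi>1 C1))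
    (branch (branch C \<phi>0 q1 \<phi>1 C0) \<xi>0 q2 \<xi>1 (branch C \<phi>0 q1 \<phi>1 C1))"
    (is "circuit_equiv B ?L ?R")
proof (rule circuit_equivI)
  let ?W = "qv ?L \<union> qv ?R"
  fix \<Psi> assume \<Psi>: "\<Psi> \<in> hilb B ?W"
  have mem: "q1 \<in> ?W" "q2 \<in> ?W" and sub: "qv (branch C0 \<xi>0 q2 \<xi>1 C1) \<subseteq> ?W"
    "qv (branch C \<phi>0 q1 \<phi>1 C0) \<subseteq> ?W" "qv (branch C \<phi>0 q1 \<phi>1 C1) \<subseteq> ?W" and "qv C \<subseteq> ?W"
    by (auto simp: qv_branch)
  have wfs: "wf_circuit B \<U> (branch C0 \<xi>0 q2 \<xi>1 C1)" "wf_circuit B \<U> (branch C \<phi>0 q1 \<phi>1 C0)"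
    "wf_circuit B \<U> (branch C \<phi>0 q1 \<phi>1 C1)" "wf_circuit B \<U> C" and on: "onb (tuples B [q2]) [\<xi>0, \<xi>1]"
    using wf wf' wf_branch by metis+
  have C: "sem_in B ?W C \<Psi> \<in> hilb B ?W"
    by (rule sem_in_hilb[OF unit wfs(4) \<open>qv C \<subseteq> ?W\<close> \<Psi>])
  let ?P = "\<lambda>\<phi>. mat_op B ?W q1 (proj \<phi>)" and ?Q = "\<lambda>\<xi>. mat_op B ?W q2 (proj \<xi>)"
  let ?E = "\<lambda>C. sem_in B ?W C \<Psi>"
  have "?E ?R = (\<lambda>x. ?P \<phi>0 (?Q \<xi>0 (?E C)) x + ?P \<phi>1 (?Q \<xi>0 (?E C0)) x +
      (?P \<phi>0 (?Q \<xi>1 (?E C)) x + ?P \<phi>1 (?Q \<xi>1 (?E C1)) x))"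
    unfolding sem_in_branch[OF q(2) wf' Un_upper2 \<Psi>] sem_in_branch[OF q(1) wfs(2) sub(2) \<Psi>]
      sem_in_branch[OF q(1) wfs(3) sub(3) \<Psi>] mat_op_add mat_op_commute[OF mem q(3)] ..
  also have "\<dots> = (\<lambda>x. (?P \<phi>0 (?Q \<xi>0 (?E C)) x + ?P \<phi>0 (?Q \<xi>1 (?E C)) x) +
      (?P \<phi>1 (?Q \<xi>0 (?E C0)) x + ?P \<phi>1 (?Q \<xi>1 (?E C1)) x))"
    by (simp add: add_ac)
  also have "\<dots> = (\<lambda>x. ?P \<phi>0 (\<lambda>x. ?Q \<xi>0 (?E C) x + ?Q \<xi>1 (?E C) x) x +
      ?P \<phi>1 (\<lambda>x. ?Q \<xi>0 (?E C0) x + ?Q \<xi>1 (?E C1) x) x)"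
    unfolding mat_op_add ..
  also have "\<dots> = ?E ?L"
    unfolding sem_in_branch[OF q(1) wf Un_upper1 \<Psi>] sem_in_branch[OF q(2) wfs(1) sub(1) \<Psi>]
      mat_op_proj_sum[OF finite_qubit[OF q(2)] mem(2) on C] ..
  finally show "?E ?L = ?E ?R"
    by (rule sym)
qed

text \<open>Distributing the outer projectors over the inner sums leaves the four terms Pi Qj Eij,
  and by \<open>reg_op_ketbra_pair\<close> the projectors of the joint register are these products
  Pi Qj.\<close>

lemma branch_nested:
  assumes q: "qubit B q1" "qubit B q2" "q1 \<noteq> q2"
    and wf: "wf_circuit B \<U> (branch (branch C00 \<xi>0 q2 \<xi>1 C01) \<phi>0 q1 \<phi>1 (branch C10 \<xi>0 q2 \<xi>1 C11))"
  shows "circuit_equiv B (branch (branch C00 \<xi>0 q2 \<xi>1 C01) \<phi>0 q1 \<phi>1 (branch C10 \<xi>0 q2 \<xi>1 C11))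
    (Qif [q1, q2] [(ket_tensor \<phi>0 \<xi>0, C00), (ket_tensor \<phi>0 \<xi>1, C01),
      (ket_tensor \<phi>1 \<xi>0, C10), (ket_tensor \<phi>1 \<xi>1, C11)])"
    (is "circuit_equiv B ?L (Qif _ ?bs)")
proof (rule circuit_equivI)
  let ?R = "Qif [q1, q2] ?bs"
  let ?W = "qv ?L \<union> qv ?R"
  fix \<Psi> assume \<Psi>: "\<Psi> \<in> hilb B ?W"
  have mem: "q1 \<in> ?W" "q2 \<in> ?W" and sub: "qv (branch C00 \<xi>0 q2 \<xi>1 C01) \<subseteq> ?W"
    "qv (branch C10 \<xi>0 q2 \<xi>1 C11) \<subseteq> ?W"
    and subC: "qv C00 \<subseteq> ?W" "qv C01 \<subseteq> ?W" "qv C10 \<subseteq> ?W" "qv C11 \<subseteq> ?W"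
    by (auto simp: qv_branch)
  have wfs: "wf_circuit B \<U> (branch C00 \<xi>0 q2 \<xi>1 C01)" "wf_circuit B \<U> (branch C10 \<xi>0 q2 \<xi>1 C11)"
    using wf wf_branch by metis+
  have wfC: "wf_circuit B \<U> C00" "wf_circuit B \<U> C01" "wf_circuit B \<U> C10" "wf_circuit B \<U> C11"
    using wfs unfolding wf_branch by blast+
  note E = sem_in_hilb[OF unit wfC(1) subC(1) \<Psi>] sem_in_hilb[OF unit wfC(2) subC(2) \<Psi>]
    sem_in_hilb[OF unit wfC(3) subC(3) \<Psi>] sem_in_hilb[OF unit wfC(4) subC(4) \<Psi>]
  note pair = reg_op_ketbra_pair[OF finite_qubit[OF q(1)] finite_qubit[OF q(2)] mem q(3)]
  have "sem_in B ?W ?R \<Psi> = (\<lambda>x. \<Sum>p\<leftarrow>?bs.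
      reg_op B ?W [q1, q2] (ketbra (tuples B [q1, q2]) (fst p)) (sem_in B ?W (snd p) \<Psi>) x)"
    by (rule sem_in_Qif[OF Un_upper2 \<Psi>]) (use E in auto)
  then show "sem_in B ?W ?L \<Psi> = sem_in B ?W ?R \<Psi>"
    unfolding sem_in_branch[OF q(1) wf Un_upper1 \<Psi>] sem_in_branch[OF q(2) wfs(1) sub(1) \<Psi>]
      sem_in_branch[OF q(2) wfs(2) sub(2) \<Psi>] mat_op_add
    by (simp only: pair[OF E(1), unfolded list.map] pair[OF E(2), unfolded list.map] pair[OF E(3), unfolded list.map] pair[OF E(4), unfolded list.map] list.map fst_conv snd_conv
        sum_list.Cons sum_list.Nil add_0_right add.assoc)
qed

end

theorem proposition4p1:
  fixes B :: "'v \<Rightarrow> 'b set" and \<U> :: "'b uconst set"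
  assumes "\<forall>U\<in>\<U>. unitary (listset (utype U)) (uop U)"
  shows
    "(\<forall>q U \<phi>0 \<phi>1 \<psi>0 \<psi>1 \<alpha>0 \<alpha>1 (C0 :: ('v, 'b) circuit) C1.
        qubit B q \<and>
        onb (tuples B [q]) [\<phi>0, \<phi>1] \<and> onb (tuples B [q]) [\<psi>0, \<psi>1] \<and>
        cmod \<alpha>0 = 1 \<and> cmod \<alpha>1 = 1 \<and>
        uop U \<phi>0 = (\<lambda>x. \<alpha>0 * \<psi>0 x) \<and> uop U \<phi>1 = (\<lambda>x. \<alpha>1 * \<psi>1 x) \<and>
        wf_circuit B \<U> (branch C0 \<psi>0 q \<psi>1 C1) \<and>
        wf_circuit B \<U> (Seq (Seq (Gate (dagger U) [q]) (branch C0 \<phi>0 q \<phi>1 C1)) (Gate U [q])) \<longrightarrow>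
        circuit_equiv B (branch C0 \<psi>0 q \<psi>1 C1)
          (Seq (Seq (Gate (dagger U) [q]) (branch C0 \<phi>0 q \<phi>1 C1)) (Gate U [q])))
   \<and> (\<forall>q \<phi>0 \<phi>1 (C0 :: ('v, 'b) circuit) C1.
        qubit B q \<and> onb (tuples B [q]) [\<phi>0, \<phi>1] \<and>
        wf_circuit B \<U> (branch C0 \<phi>0 q \<phi>1 C1) \<and>
        wf_circuit B \<U> (branch C1 \<phi>1 q \<phi>0 C0) \<longrightarrow>
        circuit_equiv B (branch C0 \<phi>0 q \<phi>1 C1) (branch C1 \<phi>1 q \<phi>0 C0))
   \<and> (\<forall>q \<phi>0 \<phi>1 (C :: ('v, 'b) circuit).
        qubit B q \<and> onb (tuples B [q]) [\<phi>0, \<phi>1] \<and>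
        wf_circuit B \<U> (branch C \<phi>0 q \<phi>1 C) \<and> wf_circuit B \<U> C \<longrightarrow>
        circuit_equiv B (branch C \<phi>0 q \<phi>1 C) C)
   \<and> (\<forall>q1 q2 \<phi>0 \<phi>1 \<xi>0 \<xi>1 (C :: ('v, 'b) circuit) C0 C1.
        qubit B q1 \<and> qubit B q2 \<and> q1 \<noteq> q2 \<and>
        onb (tuples B [q1]) [\<phi>0, \<phi>1] \<and> onb (tuples B [q2]) [\<xi>0, \<xi>1] \<and>
        q2 \<notin> qv C \<and>
        wf_circuit B \<U> (branch C \<phi>0 q1 \<phi>1 (branch C0 \<xi>0 q2 \<xi>1 C1)) \<and>
        wf_circuit B \<U> (branch (branch C \<phi>0 q1 \<phi>1 C0) \<xi>0 q2 \<xi>1 (branch C \<phi>0 q1 \<phi>1 C1)) \<longrightarrow>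
        circuit_equiv B
          (branch C \<phi>0 q1 \<phi>1 (branch C0 \<xi>0 q2 \<xi>1 C1))
          (branch (branch C \<phi>0 q1 \<phi>1 C0) \<xi>0 q2 \<xi>1 (branch C \<phi>0 q1 \<phi>1 C1)))
   \<and> (\<forall>q1 q2 \<phi>0 \<phi>1 \<xi>0 \<xi>1 (C00 :: ('v, 'b) circuit) C01 C10 C11.
        qubit B q1 \<and> qubit B q2 \<and> q1 \<noteq> q2 \<and>
        onb (tuples B [q1]) [\<phi>0, \<phi>1] \<and> onb (tuples B [q2]) [\<xi>0, \<xi>1] \<and>
        wf_circuit B \<U> (branch (branch C00 \<xi>0 q2 \<xi>1 C01) \<phi>0 q1 \<phi>1 (branch C10 \<xi>0 q2 \<xi>1 C11)) \<and>
        wf_circuit B \<U> (Qif [q1, q2]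
          [(ket_tensor \<phi>0 \<xi>0, C00), (ket_tensor \<phi>0 \<xi>1, C01),
           (ket_tensor \<phi>1 \<xi>0, C10), (ket_tensor \<phi>1 \<xi>1, C11)]) \<longrightarrow>
        circuit_equiv B
          (branch (branch C00 \<xi>0 q2 \<xi>1 C01) \<phi>0 q1 \<phi>1 (branch C10 \<xi>0 q2 \<xi>1 C11))
          (Qif [q1, q2]
            [(ket_tensor \<phi>0 \<xi>0, C00), (ket_tensor \<phi>0 \<xi>1, C01),
             (ket_tensor \<phi>1 \<xi>0, C10), (ket_tensor \<phi>1 \<xi>1, C11)]))"
  using branch_change_basis[OF assms] branch_symmetry[OF assms] branch_idempotence[OF assms]
    branch_distributivity[OF assms] branch_nested[OF assms]
  by (intro conjI allI impI; elim conjE) simp_all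

end
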